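(* Let $N$ be a nonnegative integer and let the real polynomial $$\mathcal{P}(x)=\sum_{n=0}^N a_n x^n$$ be positive for every $x\in[0,1]$. Then the inequality $$\left(\int_0^1\frac{1}{\mathcal{P}(t^2)}\,dt\right)^{-1}\le \int_{-\infty}^{\infty}\sum_{n=0}^N\frac{a_n}{\pi^{2n}}\big|g^{(n)}(x)\big|^2\,dx$$ holds for every $g\in PW^2$ with $g(0)=1$. Moreover, equality is attained if and only if $$g(z)=\left(\int_0^1\frac{1}{\mathcal{P}(t^2)}\,dt\right)^{-1}\int_0^1\frac{\cos(\pi z t)}{\mathcal{P}(t^2)}\,dt.$$
   Context: $PW^2$ is the Paley--Wiener space of entire functions $g:\mathbb{C}\to\mathbb{C}$ of exponential type at most $\pi$ whose restriction to $\mathbb{R}$ belongs to $L^2(\mathbb{R})$. An entire function $G$ has exponential type at most $\tau>0$ if for every $\varepsilon>0$ there is $C_\varepsilon>0$ with $|G(z)|\le C_\varepsilon e^{(\tau+\varepsilon)|z|}$ for all $z\in\mathbb{C}$. $g^{(n)}$ denotes the $n$-th derivative of $g$. *)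

theory Defs
  imports "HOL-Complex_Analysis.Complex_Analysis"
begin

definition exponential_type_le :: "(complex \<Rightarrow> complex) \<Rightarrow> real \<Rightarrow> bool" where
  "exponential_type_le G \<tau> \<longleftrightarrow>
     G holomorphic_on UNIV \<and>
     (\<forall>\<epsilon>>0. \<exists>C>0. \<forall>z. cmod (G z) \<le> C * exp ((\<tau> + \<epsilon>) * cmod z))"

(* g is entire, so its restriction to the real line is automatically Borel measurable;
   the integrability condition is therefore exactly membership in L^2. *)
definition PW2 :: "(complex \<Rightarrow> complex) set" where
  "PW2 = {g. exponential_type_le g pi \<and>
             integrable lborel (\<lambda>x::real. (cmod (g (complex_of_real x)))\<^sup>2)}"

end

theory Submission
  imports Defs
begin

text \<open>
  Put \<open>k z = \<integral>\<^sub>0\<^sup>1 cos (pi * z * t) / P (t\<^sup>2) dt\<close>. Integrating by parts in the energy form moves all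
  derivatives onto \<open>k\<close>, where they cancel the weight and leave \<open>\<integral>\<^sub>0\<^sup>1 cos (pi * z * t) dt = sin (pi * z) / (pi * z)\<close>;
  pairing with this function evaluates at \<open>0\<close>. Hence \<open>k\<close> represents evaluation at \<open>0\<close> in the energy form,
  and writing \<open>g = h + k / I\<close> with \<open>h 0 = 0\<close> gives \<open>E g = E h + 1 / I\<close>.

  The Paley-Wiener theorem is not needed for the positivity of \<open>E h\<close>. Bernstein's inequality says that
  \<open>- D\<^sup>2 / pi\<^sup>2\<close> lies between \<open>0\<close> and \<open>1\<close> as a quadratic form, so the numbers
  \<open>\<parallel>D\<^sup>n h\<parallel>\<^sup>2 / pi\<^sup>2\<^sup>n\<close> are completely monotone. A polynomial positive on \<open>[0,1]\<close> has positive
  coefficients in a Bernstein basis of high enough degree, hence \<open>E h \<ge> \<epsilon> * \<parallel>h\<parallel>\<^sup>2\<close>.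
\<close>

section \<open>The Phragmen-Lindelof principle\<close>

text \<open>Fourier inversion would normally supply the reproducing formula of the sine kernel. Here
  it comes from closing contours by semicircles. The obstacle is decay: after splitting the sine
  into exponentials, \<open>g\<close> times the matching exponential is only bounded on the arcs,
  and the factor \<open>1 / z\<close> merely balances their length. So \<open>g\<close> is
  multiplied by the sine kernel of \<open>\<delta> * z\<close>, which decays like
  \<open>1 / |z|\<close> and raises the type to \<open>pi * (1 + \<delta>)\<close>; the kernel is
  dilated to match, and \<delta> tends to 0 by dominated convergence. The contour estimates and
  Bernstein's inequality both need a bound \<open>M * exp (pi * |Im z|)\<close>, while membership in
  \<open>PW2\<close> controls growth only in terms of \<open>|z|\<close>; the Phragmen-Lindelof
  principle bridges the two. The coefficients \<open>a n\<close> may be negative, so positivity of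
  the energy form cannot be read off term by term. The equality case uses the lower bound with
  \<epsilon> > 0: it forces zero energy, and the reproducing formula applied to all derivatives then
  makes every Taylor coefficient at 0 vanish.\<close>

lemma phragmen_lindelof_sector:
  fixes H :: "complex \<Rightarrow> complex" and c d B C M :: real and k m :: nat
  assumes hol: "H holomorphic_on UNIV"
    and edge: "\<And>s. \<bar>Im s\<bar> = c * Re s \<Longrightarrow> cmod (H s) \<le> M"
    and growth: "\<And>s. \<bar>Im s\<bar> \<le> c * Re s \<Longrightarrow> cmod (H s) \<le> C * exp (B * cmod s ^ k)"
    and damp: "\<And>s. \<bar>Im s\<bar> \<le> c * Re s \<Longrightarrow> d * cmod s ^ m \<le> Re (s ^ m)"
    and "0 < d" "k < m" and s: "\<bar>Im s\<bar> \<le> c * Re s"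
  shows "cmod (H s) \<le> M"
proof (rule field_le_epsilon)
  fix \<eta> :: real assume "\<eta> > 0"
  have "cmod (H 0) \<le> M" by (rule edge) simp
  hence M0: "0 \<le> M" using norm_ge_zero order_trans by blast
  \<comment> \<open>The factor \<open>exp (- \<epsilon> * s ^ m)\<close> beats growth of order
    \<open>k < m\<close> on a far arc and does not exceed 1 in modulus on the edges. The maximum
    modulus principle on the truncated sector gives the bound for each fixed \<epsilon>; only
    afterwards does \<epsilon> tend to 0.\<close>
  have damped: "cmod (H s) * exp (- \<epsilon> * Re (s ^ m)) \<le> M + \<eta>" if "\<epsilon> > 0" for \<epsilon>
  proof -
    have "filterlim (\<lambda>R::real. \<epsilon> * d * R ^ m - B * R ^ k) at_top at_top"
    proof -
      have "((\<lambda>R::real. \<epsilon> * d - B * inverse (R ^ (m - k))) \<longlongrightarrow> \<epsilon> * d - B * 0) at_top"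
        using \<open>k < m\<close> by (intro tendsto_intros tendsto_inverse_0_at_top filterlim_pow_at_top filterlim_ident) auto
      hence "filterlim (\<lambda>R::real. (\<epsilon> * d - B * inverse (R ^ (m - k))) * R ^ m) at_top at_top"
        by (rule filterlim_tendsto_pos_mult_at_top[OF _ _ filterlim_pow_at_top[OF _ filterlim_ident]])
           (use \<open>0 < d\<close> \<open>\<epsilon> > 0\<close> \<open>k < m\<close> in auto)
      moreover have "\<forall>\<^sub>F R::real in at_top. (\<epsilon> * d - B * inverse (R ^ (m - k))) * R ^ m = \<epsilon> * d * R ^ m - B * R ^ k"
        using eventually_gt_at_top[of 0]
      proof eventually_elim
        case (elim R)
        have "R ^ m = R ^ (m - k) * R ^ k"
          using \<open>k < m\<close> by (simp flip: power_add)
        thus ?case using elim by (simp add: field_simps)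
      qed
      ultimately show ?thesis
        using filterlim_cong[OF refl refl] by fastforce
    qed
    hence "((\<lambda>R::real. exp (- (\<epsilon> * d * R ^ m - B * R ^ k))) \<longlongrightarrow> 0) at_top"
      by (rule filterlim_compose[OF exp_at_bot iffD1[OF filterlim_uminus_at_top]])
    hence "((\<lambda>R::real. C * exp (- (\<epsilon> * d * R ^ m - B * R ^ k))) \<longlongrightarrow> 0) at_top"
      by (rule tendsto_mult_right_zero)
    hence "\<forall>\<^sub>F R::real in at_top. C * exp (- (\<epsilon> * d * R ^ m - B * R ^ k)) < \<eta>"
      using \<open>\<eta> > 0\<close> by (intro order_tendstoD) auto
    then obtain R where R: "C * exp (- (\<epsilon> * d * R ^ m - B * R ^ k)) < \<eta>" "R > cmod s"
      using eventually_happens'[OF _ eventually_conj[OF _ eventually_gt_at_top[of "cmod s"]]]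
      by (metis (no_types, lifting) trivial_limit_at_top_linorder)
    define T where "T = {s. \<bar>Im s\<bar> \<le> c * Re s} \<inter> cball 0 R"
    define D where "D = (\<lambda>s. H s * exp (- of_real \<epsilon> * s ^ m))"
    have nD: "cmod (D z) = cmod (H z) * exp (- \<epsilon> * Re (z ^ m))" for z
      by (simp add: D_def norm_mult algebra_simps)
    have holD: "D holomorphic_on A" for A
      unfolding D_def by (intro holomorphic_intros holomorphic_on_subset[OF hol]) auto
    have "closed T" unfolding T_def
      by (intro closed_Int closed_cball closed_Collect_le continuous_intros)
    have open_T: "open ({s. \<bar>Im s\<bar> < c * Re s} \<inter> ball 0 R)"
      by (intro open_Int open_ball open_Collect_less continuous_intros)
    have front: "cmod (D z) \<le> M + \<eta>" if "z \<in> frontier T" for z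
    proof -
      have zT: "z \<in> T" using that \<open>closed T\<close> frontier_subset_eq by blast
      have "z \<notin> {s. \<bar>Im s\<bar> < c * Re s} \<inter> ball 0 R"
      proof
        assume "z \<in> {s. \<bar>Im s\<bar> < c * Re s} \<inter> ball 0 R"
        hence "z \<in> interior T"
          using open_T by (intro interiorI[OF open_T]) (auto simp: T_def)
        thus False using that by (simp add: frontier_def)
      qed
      hence cases: "\<bar>Im z\<bar> = c * Re z \<or> cmod z = R" and sec: "\<bar>Im z\<bar> \<le> c * Re z"
        using zT by (auto simp: T_def)
      have re: "d * cmod z ^ m \<le> Re (z ^ m)" by (rule damp[OF sec])
      from cases show ?thesis
      proof
        assume "\<bar>Im z\<bar> = c * Re z"
        hence "cmod (H z) \<le> M" by (rule edge)
        moreover have "exp (- \<epsilon> * Re (z ^ m)) \<le> 1"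
          using re \<open>\<epsilon> > 0\<close> \<open>d > 0\<close> by (simp add: order_trans[OF _ re])
        ultimately have "cmod (D z) \<le> M * 1"
          unfolding nD using M0 by (intro mult_mono) auto
        thus ?thesis using \<open>\<eta> > 0\<close> by simp
      next
        assume zR: "cmod z = R"
        have "cmod (D z) \<le> (C * exp (B * R ^ k)) * exp (- \<epsilon> * (d * R ^ m))"
          unfolding nD using growth[OF sec] re zR \<open>\<epsilon> > 0\<close>
          by (intro mult_mono) (auto intro: order_trans[OF norm_ge_zero])
        also have "\<dots> = C * exp (- (\<epsilon> * d * R ^ m - B * R ^ k))"
          by (simp add: algebra_simps flip: exp_add)
        finally show ?thesis using R M0 by linarith
      qed
    qed
    have "cmod (D s) \<le> M + \<eta>"
    proof (rule maximum_modulus_frontier[of D T])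
      show "continuous_on (closure T) D" using holD holomorphic_on_imp_continuous_on by blast
      show "s \<in> T" using s R by (auto simp: T_def)
      show "bounded T" unfolding T_def by (intro bounded_Int disjI2 bounded_cball)
    qed (use holD front in auto)
    thus ?thesis by (simp add: nD)
  qed
  have "((\<lambda>\<epsilon>. cmod (H s) * exp (- \<epsilon> * Re (s ^ m))) \<longlongrightarrow> cmod (H s) * exp (- 0 * Re (s ^ m))) (at_right 0)"
    by (intro tendsto_intros)
  moreover have "\<forall>\<^sub>F \<epsilon> in at_right 0. cmod (H s) * exp (- \<epsilon> * Re (s ^ m)) \<le> M + \<eta>"
    using eventually_at_right_less by (rule eventually_mono) (rule damped)
  ultimately have "cmod (H s) * exp (- 0 * Re (s ^ m)) \<le> M + \<eta>"
    by (rule tendsto_upperbound) simp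
  thus "cmod (H s) \<le> M + \<eta>" by simp
qed

text \<open>Growth of order 1 is subcritical for an opening of pi/2: a damping exponent 3/2 is
  available. Passing to a square-root coordinate turns the orders 1 and 3/2 into the integers 2 and
  3, on a sector of half-angle pi/8, where \<open>s ^ 3\<close> has positive real part because 3
  pi/8 < pi/2.\<close>

lemma phragmen_lindelof_quadrant:
  fixes G :: "complex \<Rightarrow> complex"
  assumes hol: "G holomorphic_on UNIV"
    and growth: "\<And>z. cmod (G z) \<le> C * exp (B * cmod z)"
    and re: "\<And>x. 0 \<le> x \<Longrightarrow> cmod (G (of_real x)) \<le> M"
    and im: "\<And>y. 0 \<le> y \<Longrightarrow> cmod (G (\<i> * of_real y)) \<le> M"
    and z: "0 \<le> Re z" "0 \<le> Im z"
  shows "cmod (G z) \<le> M"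
proof -
  \<comment> \<open>This is tan (pi/8); the equation \<open>c\<^sup>2 + 2 * c = 1\<close> is the
    double-angle formula for tan (pi/4) = 1.\<close>
  define c where "c = sqrt 2 - 1"
  have c: "c\<^sup>2 + 2 * c = 1" "0 < c" "c < 1/2"
  proof -
    show "c\<^sup>2 + 2 * c = 1" by (simp add: c_def power2_eq_square algebra_simps)
    show "0 < c" by (simp add: c_def)
    have "sqrt 2 < 3/2" by (rule real_less_lsqrt) (auto simp: power2_eq_square)
    thus "c < 1/2" by (simp add: c_def)
  qed
  text \<open>The map \<open>s \<mapsto> (1 + \<i>) * s\<^sup>2\<close> takes the sector \<open>\<bar>Im s\<bar> \<le> (sqrt 2 - 1) * Re s\<close> onto the quadrant.\<close>
  define H where "H = (\<lambda>s. G ((1 + \<i>) * s\<^sup>2))"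
  define s where "s = csqrt (z / (1 + \<i>))"
  have "1 + \<i> \<noteq> 0" by (simp add: complex_eq_iff)
  hence Hs: "H s = G z" by (simp add: H_def s_def)
  have s2: "s\<^sup>2 = Complex ((Re z + Im z) / 2) ((Im z - Re z) / 2)"
    by (simp add: s_def power2_csqrt complex_eq_iff Re_divide Im_divide)
  have Re_s: "0 \<le> Re s" unfolding s_def by (rule Re_csqrt)
  have e1: "(Re s)\<^sup>2 - (Im s)\<^sup>2 = (Re z + Im z) / 2" "2 * Re s * Im s = (Im z - Re z) / 2"
    using s2 by (auto simp: complex_eq_iff power2_eq_square mult_ac)
  have sec: "\<bar>Im s\<bar> \<le> c * Re s"
  proof (rule ccontr)
    assume "\<not> ?thesis"
    hence lt: "c * Re s < \<bar>Im s\<bar>" by simp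
    have "(c * Re s)\<^sup>2 < \<bar>Im s\<bar>\<^sup>2"
      using lt c Re_s by (intro power_strict_mono) auto
    moreover have "2 * Re s * \<bar>Im s\<bar> \<ge> 2 * c * (Re s)\<^sup>2"
      using mult_left_mono[OF less_imp_le[OF lt], of "2 * Re s"] Re_s by (simp add: power2_eq_square algebra_simps)
    moreover have "2 * Re s * \<bar>Im s\<bar> = \<bar>2 * Re s * Im s\<bar>" using Re_s by (simp add: abs_mult)
    moreover have "\<bar>2 * Re s * Im s\<bar> \<le> (Re s)\<^sup>2 - (Im s)\<^sup>2" unfolding e1 using z by auto
    ultimately have "(c\<^sup>2 + 2 * c) * (Re s)\<^sup>2 < (Re s)\<^sup>2"
      by (simp add: power_mult_distrib algebra_simps)
    thus False using c by simp
  qed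
  have "cmod (H s) \<le> M"
  proof (rule phragmen_lindelof_sector[where k = 2 and m = 3 and d = "1/50" and c = c and H = H and C = C and B = "B * cmod (1 + \<i>)"])
    show "H holomorphic_on UNIV" unfolding H_def
      by (rule holomorphic_on_compose_gen[of _ _ G UNIV, unfolded o_def])
         (auto intro!: holomorphic_intros hol)
  next
    fix s assume bd: "\<bar>Im s\<bar> = c * Re s"
    have c2: "c * c = 1 - 2 * c" using c by (simp add: power2_eq_square)
    have "Im s * Im s = (c * c) * (Re s * Re s)" using bd by (metis abs_mult_self_eq mult.assoc mult.left_commute)
    hence sq: "Im s * Im s = (1 - 2 * c) * (Re s * Re s)" unfolding c2 .
    consider "Im s = c * Re s" | "Im s = - (c * Re s)" using bd by linarith
    thus "cmod (H s) \<le> M"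
    proof cases
      case 1
      have "(1 + \<i>) * s\<^sup>2 = \<i> * of_real (4 * c * (Re s)\<^sup>2)"
        using sq 1 by (auto simp: complex_eq_iff power2_eq_square algebra_simps)
      thus ?thesis unfolding H_def using im[of "4 * c * (Re s)\<^sup>2"] c by simp
    next
      case 2
      have "(1 + \<i>) * s\<^sup>2 = of_real (4 * c * (Re s)\<^sup>2)"
        using sq 2 by (auto simp: complex_eq_iff power2_eq_square algebra_simps)
      thus ?thesis unfolding H_def using re[of "4 * c * (Re s)\<^sup>2"] c by simp
    qed
  next
    fix s
    have "cmod (H s) \<le> C * exp (B * (cmod (1 + \<i>) * cmod s ^ 2))"
      using growth[of "(1 + \<i>) * s\<^sup>2"] by (simp add: H_def norm_mult norm_power)
    thus "cmod (H s) \<le> C * exp (B * cmod (1 + \<i>) * cmod s ^ 2)" by (simp add: mult_ac)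
  next
    fix s assume sec: "\<bar>Im s\<bar> \<le> c * Re s"
    have "0 \<le> c * Re s" using sec abs_ge_zero order_trans by blast
    hence r: "0 \<le> Re s" using c by (simp add: zero_le_mult_iff)
    have "c * Re s \<le> 1/2 * Re s" using c r by (intro mult_right_mono) auto
    hence i: "\<bar>Im s\<bar> \<le> Re s / 2" using sec by linarith
    have "(Im s)\<^sup>2 \<le> (Re s / 2)\<^sup>2" using i r by (metis abs_ge_zero power2_abs power_mono)
    hence i2: "(Im s)\<^sup>2 \<le> (Re s)\<^sup>2 / 4" by (simp add: power_divide)
    have "cmod s \<le> 3/2 * Re s" using cmod_le[of s] i r by linarith
    hence "cmod s ^ 3 \<le> (3/2 * Re s) ^ 3" by (intro power_mono) auto
    \<comment> \<open>The estimates give \<open>cmod s ^ 3\<close> at most 27/8 times the cube of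
      \<open>Re s\<close>, and \<open>Re (s ^ 3)\<close> at least 1/4 of that cube, so any constant
      up to 2/27 would do.\<close>
    hence "1/50 * cmod s ^ 3 \<le> Re s * ((Re s)\<^sup>2 / 4)"
      using zero_le_power[OF r, of 3] by (simp add: power_mult_distrib power3_eq_cube power2_eq_square)
    also have "\<dots> \<le> Re s * ((Re s)\<^sup>2 - 3 * (Im s)\<^sup>2)"
      using i2 r by (intro mult_left_mono) auto
    also have "\<dots> = Re (s ^ 3)" by (simp add: power3_eq_cube power2_eq_square algebra_simps)
    finally show "1/50 * cmod s ^ 3 \<le> Re (s ^ 3)" .
  qed (use sec in auto)
  thus ?thesis using Hs by simp
qed

text \<open>An opening of pi is critical for order 1, so boundedness by some \<open>K\<close> is
  assumed here. Damping by \<open>exp (- \<epsilon> * s)\<close> in the square-root coordinate then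
  improves \<open>K\<close> to the bound \<open>M\<close> on the boundary.\<close>

lemma phragmen_lindelof_half_plane:
  fixes G :: "complex \<Rightarrow> complex"
  assumes hol: "G holomorphic_on UNIV"
    and bounded: "\<And>z. 0 \<le> Im z \<Longrightarrow> cmod (G z) \<le> K"
    and re: "\<And>x. cmod (G (of_real x)) \<le> M"
    and z: "0 \<le> Im z"
  shows "cmod (G z) \<le> M"
proof -
  text \<open>The map \<open>s \<mapsto> \<i> * s\<^sup>2\<close> takes the sector \<open>\<bar>Im s\<bar> \<le> Re s\<close> onto the half-plane.\<close>
  define H where "H = (\<lambda>s. G (\<i> * s\<^sup>2))"
  define s where "s = csqrt (- \<i> * z)"
  have Hs: "H s = G z" by (simp add: H_def s_def)
  have "Re (s\<^sup>2) = Im z" by (simp add: s_def)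
  hence "(Im s)\<^sup>2 \<le> (Re s)\<^sup>2" using z by (simp add: power2_eq_square)
  moreover have "0 \<le> Re s" unfolding s_def by (rule Re_csqrt)
  ultimately have sec: "\<bar>Im s\<bar> \<le> 1 * Re s" by (simp flip: abs_le_square_iff)
  have "cmod (H s) \<le> M"
  proof (rule phragmen_lindelof_sector[where k = 0 and m = 1 and d = "1/2" and c = 1 and C = K and B = 0 and H = H])
    show "H holomorphic_on UNIV" unfolding H_def
      by (rule holomorphic_on_compose_gen[of _ _ G UNIV, unfolded o_def])
         (auto intro!: holomorphic_intros hol)
  next
    fix s assume "\<bar>Im s\<bar> = 1 * Re s"
    hence "(Im s)\<^sup>2 = (Re s)\<^sup>2" by (metis mult_1 power2_abs)
    hence "\<i> * s\<^sup>2 = of_real (- 2 * Re s * Im s)" by (simp add: complex_eq_iff power2_eq_square)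
    thus "cmod (H s) \<le> M" unfolding H_def using re by metis
  next
    fix s assume "\<bar>Im s\<bar> \<le> 1 * Re s"
    hence "(Im s)\<^sup>2 \<le> (Re s)\<^sup>2" by (metis abs_ge_zero mult_1 power2_abs power_mono)
    hence "0 \<le> Im (\<i> * s\<^sup>2)" by (simp add: power2_eq_square)
    thus "cmod (H s) \<le> K * exp (0 * cmod s ^ 0)" unfolding H_def using bounded by simp
  next
    fix s assume "\<bar>Im s\<bar> \<le> 1 * Re s"
    thus "1/2 * cmod s ^ 1 \<le> Re (s ^ 1)" using cmod_le[of s] by simp
  qed (use sec in auto)
  thus ?thesis using Hs by simp
qed

text \<open>Multiplying by \<open>exp (\<i> * (\<tau> + \<epsilon>) * z)\<close> leaves moduli on
  the line unchanged and makes the function bounded by \<open>C\<close> on the positive imaginary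
  axis. The two quadrants give the crude bound \<open>max M C\<close>, and the half-plane principle
  removes the uncontrolled \<open>C\<close>, so that \<epsilon> can tend to 0.\<close>

lemma exponential_type_le_upper_bound:
  assumes type: "exponential_type_le G \<tau>"
    and re: "\<And>x. cmod (G (of_real x)) \<le> M" and "0 \<le> Im z"
  shows "cmod (G z) \<le> M * exp (\<tau> * Im z)"
proof -
  have hol: "G holomorphic_on UNIV" using type by (simp add: exponential_type_le_def)
  have eps: "cmod (G z) \<le> M * exp ((\<tau> + \<epsilon>) * Im z)" if "\<epsilon> > 0" for \<epsilon>
  proof -
    obtain C where C: "C > 0" "\<And>z. cmod (G z) \<le> C * exp ((\<tau> + \<epsilon>) * cmod z)"
      using type \<open>\<epsilon> > 0\<close> unfolding exponential_type_le_def by blast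
    define D where "D = (\<lambda>z. G z * exp (\<i> * of_real (\<tau> + \<epsilon>) * z))"
    have nD: "cmod (D z) = cmod (G z) * exp (- (\<tau> + \<epsilon>) * Im z)" for z
      by (simp add: D_def norm_mult algebra_simps)
    have holD: "D holomorphic_on UNIV" unfolding D_def by (intro holomorphic_intros hol)
    have holD': "(\<lambda>z. D (\<i> * z)) holomorphic_on UNIV"
      by (rule holomorphic_on_compose_gen[of _ _ D UNIV, unfolded o_def])
         (auto intro!: holomorphic_intros holD)
    have growth: "cmod (D z) \<le> C * exp ((2 * \<bar>\<tau> + \<epsilon>\<bar>) * cmod z)" for z
    proof -
      have "- (\<tau> + \<epsilon>) * Im z \<le> \<bar>- (\<tau> + \<epsilon>) * Im z\<bar>" by (rule abs_ge_self)
      also have "\<dots> \<le> \<bar>\<tau> + \<epsilon>\<bar> * cmod z"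
        unfolding abs_mult abs_minus_cancel by (intro mult_left_mono abs_Im_le_cmod) auto
      finally have le: "- (\<tau> + \<epsilon>) * Im z \<le> \<bar>\<tau> + \<epsilon>\<bar> * cmod z" .
      have "cmod (D z) \<le> (C * exp ((\<tau> + \<epsilon>) * cmod z)) * exp (\<bar>\<tau> + \<epsilon>\<bar> * cmod z)"
        unfolding nD using C le by (intro mult_mono) auto
      also have "\<dots> \<le> (C * exp (\<bar>\<tau> + \<epsilon>\<bar> * cmod z)) * exp (\<bar>\<tau> + \<epsilon>\<bar> * cmod z)"
        using C by (intro mult_mono) (auto intro!: mult_right_mono)
      also have "\<dots> = C * exp ((2 * \<bar>\<tau> + \<epsilon>\<bar>) * cmod z)"
        by (simp add: mult.assoc flip: exp_add)
      finally show ?thesis .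
    qed
    have reD: "cmod (D (of_real x)) \<le> M" for x using re[of x] by (simp add: nD)
    have imD: "cmod (D (\<i> * of_real y)) \<le> C" if "y \<ge> 0" for y
      using C(2)[of "\<i> * of_real y"] that by (simp add: nD norm_mult exp_minus exp_diff exp_add field_simps)
    define K where "K = max M C"
    have bounded: "cmod (D w) \<le> K" if "0 \<le> Im w" for w
    proof (cases "0 \<le> Re w")
      case True
      show ?thesis
        by (rule phragmen_lindelof_quadrant[OF holD growth])
           (use that True reD imD in \<open>auto simp: K_def le_max_iff_disj\<close>)
    next
      case False
      \<comment> \<open>Multiplication by \<open>- \<i>\<close> carries the second quadrant onto the
        first.\<close>
      have "cmod (D (\<i> * (- \<i> * w))) \<le> K"
      proof (rule phragmen_lindelof_quadrant[OF holD'])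
        show "cmod (D (\<i> * z)) \<le> C * exp ((2 * \<bar>\<tau> + \<epsilon>\<bar>) * cmod z)" for z
          using growth[of "\<i> * z"] by (simp add: norm_mult)
        show "cmod (D (\<i> * (\<i> * of_real y))) \<le> K" for y
          using reD[of "-y"] by (simp add: K_def le_max_iff_disj flip: mult.assoc)
      qed (use that False imD in \<open>auto simp: K_def le_max_iff_disj\<close>)
      thus ?thesis by (simp flip: mult.assoc)
    qed
    have "cmod (D z) \<le> M"
      by (rule phragmen_lindelof_half_plane[OF holD bounded reD \<open>0 \<le> Im z\<close>])
    thus ?thesis by (simp add: nD exp_minus exp_add exp_diff field_simps)
  qed
  have "((\<lambda>\<epsilon>. M * exp ((\<tau> + \<epsilon>) * Im z)) \<longlongrightarrow> M * exp ((\<tau> + 0) * Im z)) (at_right 0)"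
    by (intro tendsto_intros)
  moreover have "\<forall>\<^sub>F \<epsilon> in at_right 0. cmod (G z) \<le> M * exp ((\<tau> + \<epsilon>) * Im z)"
    using eventually_at_right_less by (rule eventually_mono) (rule eps)
  ultimately have "cmod (G z) \<le> M * exp ((\<tau> + 0) * Im z)"
    by (rule tendsto_lowerbound) simp
  thus ?thesis by simp
qed

lemma exponential_type_le_strip_bound:
  assumes type: "exponential_type_le G \<tau>" and re: "\<And>x. cmod (G (of_real x)) \<le> M"
  shows "cmod (G z) \<le> M * exp (\<tau> * \<bar>Im z\<bar>)"
proof (cases "0 \<le> Im z")
  case True
  thus ?thesis using exponential_type_le_upper_bound[OF assms] by simp
next
  case False
  have "G holomorphic_on UNIV" using type unfolding exponential_type_le_def by blast
  hence "(\<lambda>z. G (- z)) holomorphic_on UNIV"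
    by (rule holomorphic_on_compose_gen[of _ _ G UNIV, unfolded o_def, rotated])
       (auto intro!: holomorphic_intros)
  moreover have "\<exists>C>0. \<forall>z. cmod (G (- z)) \<le> C * exp ((\<tau> + \<epsilon>) * cmod z)" if "\<epsilon> > 0" for \<epsilon>
    using type that unfolding exponential_type_le_def by (metis norm_minus_cancel)
  ultimately have "exponential_type_le (\<lambda>z. G (- z)) \<tau>"
    unfolding exponential_type_le_def by blast
  from exponential_type_le_upper_bound[OF this, of M "- z"] re[of "- _"] False
  show ?thesis by simp
qed

section \<open>Integrals over the real line\<close>

lemma integrable_lborel_of_bounded_truncations:
  fixes h :: "real \<Rightarrow> real"
  assumes cont: "continuous_on UNIV h" and nonneg: "\<And>x. 0 \<le> h x"
    and bound: "\<And>A. 0 < A \<Longrightarrow> integral {-A..A} h \<le> Q"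
  shows "integrable lborel h" and "(LINT x|lborel. h x) \<le> Q"
proof -
  \<comment> \<open>\<open>Suc n\<close> keeps the half-length positive, as \<open>bound\<close>
    demands.\<close>
  define f where "f = (\<lambda>n::nat. \<lambda>x. indicator {- real (Suc n)..real (Suc n)} x * h x)"
  have conth: "continuous_on S h" for S by (rule continuous_on_subset[OF cont]) auto
  have si: "set_integrable lborel {a..b} h" for a b :: real
    by (rule borel_integrable_atLeastAtMost'[OF conth])
  have int_f: "integrable lborel (f n)" for n
    using si[of "- real (Suc n)" "real (Suc n)"] by (simp add: f_def set_integrable_def)
  have val: "integral\<^sup>L lborel (f n) \<le> Q" for n
  proof -
    have "integral\<^sup>L lborel (f n) = integral {- real (Suc n)..real (Suc n)} h"
      using set_borel_integral_eq_integral(2)[OF si[of "- real (Suc n)" "real (Suc n)"]]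
      by (simp add: f_def set_lebesgue_integral_def)
    thus ?thesis using bound[of "real (Suc n)"] by simp
  qed
  have mono_f: "mono (\<lambda>n. f n x)" for x
    by (rule monoI) (auto simp: f_def nonneg split: split_indicator)
  have "incseq (\<lambda>n. integral\<^sup>L lborel (f n))"
    by (rule monoI) (intro integral_mono int_f monoD[OF mono_f])
  then obtain L where L: "(\<lambda>n. integral\<^sup>L lborel (f n)) \<longlonglongrightarrow> L"
    using incseq_convergent[of "\<lambda>n. integral\<^sup>L lborel (f n)" Q] val by blast
  have lim: "(\<lambda>n. f n x) \<longlonglongrightarrow> h x" for x
  proof (rule tendsto_eventually, unfold eventually_sequentially)
    obtain N :: nat where "\<bar>x\<bar> \<le> real N" using real_arch_simple by blast
    thus "\<exists>N. \<forall>n\<ge>N. f n x = h x"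
      by (intro exI[of _ N]) (auto simp: f_def split: split_indicator)
  qed
  have meas: "h \<in> borel_measurable lborel"
    using cont by (simp add: borel_measurable_continuous_onI)
  show "integrable lborel h"
    by (rule integrable_monotone_convergence[OF int_f _ _ L meas]) (use mono_f lim in auto)
  have "(LINT x|lborel. h x) = L"
    by (rule integral_monotone_convergence[OF int_f _ _ L meas]) (use mono_f lim in auto)
  moreover have "L \<le> Q" by (rule LIMSEQ_le_const2[OF L]) (use val in auto)
  ultimately show "(LINT x|lborel. h x) \<le> Q" by simp
qed

lemma square_integrable_mult:
  fixes u v :: "real \<Rightarrow> complex"
  assumes "u \<in> borel_measurable lborel" "v \<in> borel_measurable lborel"
    and "integrable lborel (\<lambda>x. (cmod (u x))\<^sup>2)" "integrable lborel (\<lambda>x. (cmod (v x))\<^sup>2)"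
  shows "integrable lborel (\<lambda>x. u x * v x)"
proof (rule Bochner_Integration.integrable_bound)
  show "integrable lborel (\<lambda>x. (cmod (u x))\<^sup>2 + (cmod (v x))\<^sup>2)" using assms by simp
  have "cmod (u x * v x) \<le> (cmod (u x))\<^sup>2 + (cmod (v x))\<^sup>2" for x
    using sum_squares_bound[of "cmod (u x)" "cmod (v x)"]
      mult_nonneg_nonneg[OF norm_ge_zero[of "u x"] norm_ge_zero[of "v x"]]
    unfolding norm_mult by linarith
  thus "AE x in lborel. norm (u x * v x) \<le> norm ((cmod (u x))\<^sup>2 + (cmod (v x))\<^sup>2)" by simp
qed (use assms in measurable)

lemma tendsto_integral_truncation:
  fixes u :: "real \<Rightarrow> complex"
  assumes cont: "continuous_on UNIV u" and int: "integrable lborel u"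
  shows "((\<lambda>b. integral {-b..b} u) \<longlongrightarrow> (LINT x|lborel. u x)) at_top"
proof -
  have "((\<lambda>b. LINT x|lborel. indicator {-b..b} x *\<^sub>R u x) \<longlongrightarrow> (LINT x|lborel. u x)) at_top"
  proof (rule integral_dominated_convergence_at_top[where w = "\<lambda>x. cmod (u x)"])
    show "AE x in lborel. ((\<lambda>b. indicator {-b..b} x *\<^sub>R u x) \<longlongrightarrow> u x) at_top"
    proof (rule AE_I2, rule tendsto_eventually)
      fix x :: real
      show "\<forall>\<^sub>F b in at_top. indicator {-b..b} x *\<^sub>R u x = u x"
        using eventually_ge_at_top[of "\<bar>x\<bar>"] by eventually_elim (simp add: indicator_def abs_le_iff)
    qed
    show "\<forall>\<^sub>F b in at_top. AE x in lborel. norm (indicator {-b..b} x *\<^sub>R u x) \<le> cmod (u x)"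
      by (auto split: split_indicator)
  qed (use int in \<open>auto simp: integrable_norm\<close>)
  moreover have "(LINT x:{-b..b}|lborel. u x) = integral {-b..b} u" for b
    by (rule set_borel_integral_eq_integral(2)[OF borel_integrable_atLeastAtMost'])
       (rule continuous_on_subset[OF cont], simp)
  ultimately show ?thesis by (simp add: set_lebesgue_integral_def)
qed

text \<open>Integrability of \<open>U\<close> stands in for decay at infinity: a nonzero limit of
  \<open>U b - U (- b)\<close> would keep this integrable function away from 0 on a half-line of
  infinite measure.\<close>

lemma integral_derivative_eq_0:
  fixes U u :: "real \<Rightarrow> complex"
  assumes deriv: "\<And>x. (U has_vector_derivative u x) (at x)" and cont: "continuous_on UNIV u"
    and int_U: "integrable lborel U" and int_u: "integrable lborel u"
  shows "(LINT x|lborel. u x) = 0"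
proof (rule ccontr)
  define c where "c = (LINT x|lborel. u x)"
  assume "(LINT x|lborel. u x) \<noteq> 0"
  hence c: "0 < cmod c" by (simp add: c_def)
  have "integral {-b..b} u = U b - U (- b)" if "b \<ge> 0" for b
    using that by (intro integral_unique fundamental_theorem_of_calculus)
      (auto intro: has_vector_derivative_at_within deriv)
  hence "\<forall>\<^sub>F b in at_top. integral {-b..b} u = U b - U (- b)"
    by (rule eventually_mono[OF eventually_ge_at_top[of 0]])
  with tendsto_integral_truncation[OF cont int_u] have "((\<lambda>b. U b - U (- b)) \<longlongrightarrow> c) at_top"
    unfolding c_def by (rule Lim_transform_eventually)
  hence "((\<lambda>b. cmod (U b - U (- b))) \<longlongrightarrow> cmod c) at_top" by (rule tendsto_norm)
  hence "\<forall>\<^sub>F b in at_top. cmod c / 2 < cmod (U b - U (- b))"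
    using c by (intro order_tendstoD) auto
  then obtain X where X: "\<And>b. b \<ge> X \<Longrightarrow> cmod c / 2 < cmod (U b - U (- b))"
    by (auto simp: eventually_at_top_linorder)
  have int_minus: "integrable lborel (\<lambda>x. U (- x))"
    using lborel_integrable_real_affine[OF int_U, of "-1" 0] by simp
  have "integrable lborel (indicator {X..} :: real \<Rightarrow> real)"
  proof (rule Bochner_Integration.integrable_bound)
    show "integrable lborel (\<lambda>x. 2 / cmod c * cmod (U x - U (- x)))"
      using int_U int_minus by (intro integrable_mult_right integrable_norm) auto
    show "AE x in lborel. norm (indicator {X..} x :: real) \<le> norm (2 / cmod c * cmod (U x - U (- x)))"
      using c X by (auto simp: field_simps less_imp_le split: split_indicator)
  qed simp
  hence "emeasure lborel {X..} < \<infinity>" by (simp add: integrable_indicator_iff)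
  moreover have "emeasure lborel {X..} = \<infinity>"
  proof -
    have "ennreal n \<le> emeasure lborel {X..}" if "n \<ge> 0" for n :: real
    proof -
      have "ennreal n = emeasure lborel {X..X + n}" using that by simp
      also have "\<dots> \<le> emeasure lborel {X..}" by (rule emeasure_mono) auto
      finally show ?thesis .
    qed
    hence "of_nat n \<le> emeasure lborel {X..}" for n
      by (metis ennreal_of_nat_eq_real_of_nat of_nat_0_le_iff)
    thus ?thesis using ennreal_Ex_less_of_nat linorder_not_less top.not_eq_extremum infinity_ennreal_def by metis
  qed
  ultimately show False by simp
qed

text \<open>Applied to the square of a Paley-Wiener function, this yields boundedness on the
  line.\<close>

lemma norm_le_integral_norm_derivative:
  fixes U u :: "real \<Rightarrow> complex"
  assumes deriv: "\<And>x. (U has_vector_derivative u x) (at x)" and cont: "continuous_on UNIV u"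
    and int_u: "integrable lborel u"
  shows "cmod (U x) \<le> cmod (U 0) + (LINT x|lborel. cmod (u x))"
proof -
  define a b where "a = min 0 x" and "b = max 0 x"
  have "a \<le> b" by (simp add: a_def b_def)
  have si: "set_integrable lborel {a..b} u"
    by (rule borel_integrable_atLeastAtMost') (rule continuous_on_subset[OF cont], simp)
  have "U b - U a = integral {a..b} u"
    using \<open>a \<le> b\<close> by (intro integral_unique[symmetric] fundamental_theorem_of_calculus)
      (auto intro: has_vector_derivative_at_within deriv)
  also have "\<dots> = (LINT x|lborel. indicator {a..b} x *\<^sub>R u x)"
    using set_borel_integral_eq_integral(2)[OF si] by (simp add: set_lebesgue_integral_def)
  finally have "cmod (U b - U a) \<le> (LINT x|lborel. cmod (indicator {a..b} x *\<^sub>R u x))"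
    by (metis integral_norm_bound)
  also have "\<dots> \<le> (LINT x|lborel. cmod (u x))"
    using si int_u by (intro integral_mono integrable_norm)
      (auto simp: set_integrable_def split: split_indicator)
  finally have "cmod (U b - U a) \<le> (LINT x|lborel. cmod (u x))" .
  moreover have "cmod (U x - U 0) = cmod (U b - U a)"
    by (auto simp: a_def b_def min_def max_def norm_minus_commute)
  ultimately show ?thesis using norm_triangle_ineq2[of "U x" "U 0"] by linarith
qed

lemma holomorphic_on_line:
  assumes "f holomorphic_on UNIV"
  shows "continuous_on S (\<lambda>x::real. f (of_real x))"
    and "(\<lambda>x::real. f (of_real x)) \<in> borel_measurable lborel"
    and "((\<lambda>x::real. f (of_real x)) has_vector_derivative deriv f (of_real x)) (at x)"
proof -
  have c: "continuous_on S (\<lambda>x::real. f (of_real x))" for S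
    by (rule continuous_on_compose2[OF holomorphic_on_imp_continuous_on[OF assms]])
       (auto intro!: continuous_intros)
  thus "continuous_on S (\<lambda>x::real. f (of_real x))" .
  show "(\<lambda>x::real. f (of_real x)) \<in> borel_measurable lborel"
    using c[of UNIV] by (simp add: borel_measurable_continuous_onI)
  have "(f has_field_derivative deriv f (of_real x)) (at (of_real x))"
    using assms by (intro holomorphic_derivI[of _ UNIV]) auto
  thus "((\<lambda>x::real. f (of_real x)) has_vector_derivative deriv f (of_real x)) (at x)"
    by (rule has_vector_derivative_real_field)
qed

lemma integrable_inverse_1_plus_square_real: "integrable lborel (\<lambda>x::real. inverse (1 + x\<^sup>2))"
proof (rule integrable_lborel_of_bounded_truncations(1))
  have nz: "1 + x\<^sup>2 \<noteq> 0" for x :: real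
    by (metis add_pos_nonneg less_irrefl zero_le_power2 zero_less_one)
  show "continuous_on UNIV (\<lambda>x::real. inverse (1 + x\<^sup>2))"
    using nz by (intro continuous_intros) auto
  fix A :: real assume "A > 0"
  hence "integral {-A..A} (\<lambda>x. inverse (1 + x\<^sup>2)) = arctan A - arctan (- A)"
    by (intro integral_unique fundamental_theorem_of_calculus)
       (auto intro!: has_field_derivative_at_within[OF DERIV_arctan]
             simp flip: has_real_derivative_iff_has_vector_derivative)
  thus "integral {-A..A} (\<lambda>x. inverse (1 + x\<^sup>2)) \<le> pi"
    using arctan_ubound[of A] arctan_lbound[of A] by (simp add: arctan_minus)
qed simp

section \<open>Energy on the line and derivatives of Paley-Wiener functions\<close>

lemma pairing_has_field_derivative:
  assumes f: "f holomorphic_on UNIV" and \<psi>: "continuous_on {a..b} \<psi>"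
  shows "((\<lambda>z. integral {a..b} (\<lambda>t. f (z + of_real t) * \<psi> t)) has_field_derivative
           integral {a..b} (\<lambda>t. deriv f (z + of_real t) * \<psi> t)) (at z)"
proof -
  have cf: "continuous_on UNIV f" by (rule holomorphic_on_imp_continuous_on[OF f])
  have cd: "continuous_on UNIV (deriv f)"
    by (rule holomorphic_on_imp_continuous_on) (auto intro: holomorphic_deriv f)
  have "((\<lambda>z. integral (cbox a b) (\<lambda>t. f (z + of_real t) * \<psi> t)) has_field_derivative
           integral (cbox a b) (\<lambda>t. deriv f (z + of_real t) * \<psi> t)) (at z within UNIV)"
  proof (rule leibniz_rule_field_derivative)
    fix x :: complex and t :: real assume "t \<in> cbox a b"
    have "(f has_field_derivative deriv f (x + of_real t)) (at (x + of_real t))"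
      using f by (intro holomorphic_derivI[of _ UNIV]) auto
    hence "((\<lambda>x. f (x + of_real t)) has_field_derivative deriv f (x + of_real t)) (at x)"
      by (simp add: DERIV_shift)
    thus "((\<lambda>x. f (x + of_real t) * \<psi> t) has_field_derivative deriv f (x + of_real t) * \<psi> t) (at x within UNIV)"
      by (auto intro!: DERIV_cmult_right)
  next
    show "(\<lambda>t. f (x + of_real t) * \<psi> t) integrable_on cbox a b" for x
      by (intro integrable_continuous continuous_intros continuous_on_compose2[OF cf])
         (use \<psi> in auto)
    show "continuous_on (UNIV \<times> cbox a b) (\<lambda>(x, t). deriv f (x + of_real t) * \<psi> t)"
      unfolding split_beta
      by (intro continuous_intros continuous_on_compose2[OF cd] continuous_on_compose2[OF \<psi>]) auto
  qed auto
  thus ?thesis by simp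
qed

lemma higher_deriv_pairing:
  assumes "f holomorphic_on UNIV" and \<psi>: "continuous_on {a..b} \<psi>"
  shows "(deriv ^^ n) (\<lambda>z. integral {a..b} (\<lambda>t. f (z + of_real t) * \<psi> t))
         = (\<lambda>z. integral {a..b} (\<lambda>t. (deriv ^^ n) f (z + of_real t) * \<psi> t))"
proof (induction n)
  case (Suc n)
  have "(deriv ^^ n) f holomorphic_on UNIV" by (intro holomorphic_higher_deriv assms) auto
  from DERIV_imp_deriv[OF pairing_has_field_derivative[OF this \<psi>]]
  show ?case by (simp add: Suc.IH fun_eq_iff)
qed simp

definition line_energy :: "(complex \<Rightarrow> complex) \<Rightarrow> real" where
  "line_energy f = (LINT x|lborel. (cmod (f (of_real x)))\<^sup>2)"

lemma line_energy_nonneg: "0 \<le> line_energy f"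
  by (simp add: line_energy_def)

lemma PW2_D:
  assumes "f \<in> PW2"
  shows "exponential_type_le f pi" "f holomorphic_on UNIV"
    "integrable lborel (\<lambda>x. (cmod (f (of_real x)))\<^sup>2)"
  using assms by (auto simp: PW2_def exponential_type_le_def)

text \<open>On the line the arithmetic-geometric mean inequality and translation invariance give the
  bound; translating by at most \<open>A\<close> costs only a constant in the growth estimate, so
  \<open>F\<close> keeps type pi and the strip bound applies. The weight \<open>c\<close> is left
  free to be balanced against the Cauchy constant later.\<close>

lemma pairing_bound:
  assumes f: "f \<in> PW2" and \<psi>: "continuous_on {-A..A} \<psi>" and "0 < A" "0 < c"
  defines "F \<equiv> \<lambda>z. integral {-A..A} (\<lambda>t. f (z + of_real t) * \<psi> t)"
  shows "cmod (F z) \<le> (c * line_energy f + integral {-A..A} (\<lambda>t. (cmod (\<psi> t))\<^sup>2) / c) / 2 * exp (pi * \<bar>Im z\<bar>)"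
proof (rule exponential_type_le_strip_bound)
  have hol: "f holomorphic_on UNIV" and int: "integrable lborel (\<lambda>x. (cmod (f (of_real x)))\<^sup>2)"
    using PW2_D[OF f] by auto
  have cf: "continuous_on UNIV f" by (rule holomorphic_on_imp_continuous_on[OF hol])
  have c1: "continuous_on {-A..A} (\<lambda>t. f (z + of_real t))" for z
    by (rule continuous_on_compose2[OF cf]) (auto intro!: continuous_intros)
  have c2: "continuous_on {-A..A} (\<lambda>t. f (z + of_real t) * \<psi> t)" for z
    by (intro continuous_intros c1 \<psi>)
  have "F holomorphic_on UNIV"
    using pairing_has_field_derivative[OF hol \<psi>]
    unfolding F_def by (auto simp: holomorphic_on_def field_differentiable_def intro: has_field_derivative_at_within)
  moreover have "\<exists>C>0. \<forall>z. cmod (F z) \<le> C * exp ((pi + \<epsilon>) * cmod z)" if "\<epsilon> > 0" for \<epsilon>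
  proof -
    obtain C where C: "C > 0" "\<And>z. cmod (f z) \<le> C * exp ((pi + \<epsilon>) * cmod z)"
      using PW2_D(1)[OF f] \<open>\<epsilon> > 0\<close> unfolding exponential_type_le_def by blast
    have "bounded (\<psi> ` {-A..A})" by (intro compact_imp_bounded compact_continuous_image \<psi>) auto
    then obtain B where B: "B > 0" "\<And>t. t \<in> {-A..A} \<Longrightarrow> cmod (\<psi> t) \<le> B"
      by (auto simp: bounded_pos)
    have "cmod (F z) \<le> C * exp ((pi + \<epsilon>) * (cmod z + A)) * B * (A - - A)" for z
      unfolding F_def
    proof (rule integral_bound[OF _ c2])
      fix t assume t: "t \<in> {-A..A}"
      have "cmod (f (z + of_real t)) \<le> C * exp ((pi + \<epsilon>) * cmod (z + of_real t))" by (rule C)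
      also have "cmod (z + of_real t) \<le> cmod z + A"
        using norm_triangle_ineq[of z "of_real t"] t by auto
      hence "C * exp ((pi + \<epsilon>) * cmod (z + of_real t)) \<le> C * exp ((pi + \<epsilon>) * (cmod z + A))"
        using C(1) that by (simp add: add_pos_pos)
      finally show "cmod (f (z + of_real t) * \<psi> t) \<le> C * exp ((pi + \<epsilon>) * (cmod z + A)) * B"
        unfolding norm_mult using B t C(1) by (intro mult_mono) auto
    qed (use \<open>0 < A\<close> in auto)
    hence "cmod (F z) \<le> (C * exp ((pi + \<epsilon>) * A) * B * (2 * A)) * exp ((pi + \<epsilon>) * cmod z)" for z
      by (simp add: distrib_left exp_add mult_ac)
    moreover have "0 < C * exp ((pi + \<epsilon>) * A) * B * (2 * A)" using C B \<open>0 < A\<close> by simp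
    ultimately show ?thesis by blast
  qed
  ultimately show "exponential_type_le F pi" by (simp add: exponential_type_le_def)
next
  fix x :: real
  have hol: "f holomorphic_on UNIV" and int: "integrable lborel (\<lambda>x. (cmod (f (of_real x)))\<^sup>2)"
    using PW2_D[OF f] by auto
  note cl = holomorphic_on_line(1)[OF hol]
  have c1: "continuous_on {-A..A} (\<lambda>t. f (of_real (x + t)))"
    by (rule continuous_on_compose2[OF cl[of UNIV]]) (auto intro!: continuous_intros)
  have "cmod (F (of_real x)) \<le> integral {-A..A} (\<lambda>t. (c * (cmod (f (of_real (x + t))))\<^sup>2 + (cmod (\<psi> t))\<^sup>2 / c) / 2)"
    unfolding F_def
  proof (rule integral_norm_bound_integral)
    show "(\<lambda>t. f (of_real x + of_real t) * \<psi> t) integrable_on {-A..A}"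
      using c1 \<psi> by (intro integrable_continuous_real continuous_intros) simp_all
    show "(\<lambda>t. (c * (cmod (f (of_real (x + t))))\<^sup>2 + (cmod (\<psi> t))\<^sup>2 / c) / 2) integrable_on {-A..A}"
      using c1 \<psi> \<open>0 < c\<close> by (intro integrable_continuous_real continuous_intros) simp_all
    fix t :: real
    define p q where "p = cmod (f (of_real (x + t)))" and "q = cmod (\<psi> t)"
    have "0 \<le> (c * p - q)\<^sup>2" by simp
    hence "2 * (c * (p * q)) \<le> c * (c * p\<^sup>2) + q\<^sup>2" by (simp add: power2_eq_square algebra_simps)
    also have "c * (c * p\<^sup>2) + q\<^sup>2 = c * (c * p\<^sup>2 + q\<^sup>2 / c)" using \<open>0 < c\<close> by (simp add: field_simps)
    finally have "c * (2 * (p * q)) \<le> c * (c * p\<^sup>2 + q\<^sup>2 / c)" by (simp add: mult_ac)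
    hence "p * q \<le> (c * p\<^sup>2 + q\<^sup>2 / c) / 2" using \<open>0 < c\<close> by simp
    thus "norm (f (of_real x + of_real t) * \<psi> t) \<le> (c * (cmod (f (of_real (x + t))))\<^sup>2 + (cmod (\<psi> t))\<^sup>2 / c) / 2"
      by (simp add: p_def q_def norm_mult)
  qed
  also have "\<dots> = (c * integral {-A..A} (\<lambda>t. (cmod (f (of_real (x + t))))\<^sup>2)
                   + integral {-A..A} (\<lambda>t. (cmod (\<psi> t))\<^sup>2) / c) / 2"
  proof -
    have "(\<lambda>t. (cmod (f (of_real (x + t))))\<^sup>2) integrable_on {-A..A}"
      "(\<lambda>t. (cmod (\<psi> t))\<^sup>2) integrable_on {-A..A}"
      using c1 \<psi> by (intro integrable_continuous_real continuous_intros; simp)+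
    from this[THEN integrable_integral] show ?thesis
      by (intro integral_unique has_integral_divide has_integral_add has_integral_mult_right)
  qed
  also have "integral {-A..A} (\<lambda>t. (cmod (f (of_real (x + t))))\<^sup>2) \<le> line_energy f"
  proof -
    let ?h = "\<lambda>t. (cmod (f (of_real (x + t))))\<^sup>2"
    have si: "set_integrable lborel {-A..A} ?h"
      by (intro borel_integrable_atLeastAtMost' continuous_intros c1)
    have ih: "integrable lborel ?h" using lborel_integrable_real_affine[OF int, of 1 x] by simp
    have "integral {-A..A} ?h = (LINT t|lborel. indicator {-A..A} t *\<^sub>R ?h t)"
      using set_borel_integral_eq_integral(2)[OF si] by (simp add: set_lebesgue_integral_def)
    also have "\<dots> \<le> (LINT t|lborel. ?h t)"
      using si ih by (intro integral_mono) (auto simp: set_integrable_def split: split_indicator)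
    also have "\<dots> = line_energy f"
      using lborel_integral_real_affine[of 1 "\<lambda>x. (cmod (f (of_real x)))\<^sup>2" x] by (simp add: line_energy_def)
    finally show ?thesis .
  qed
  finally show "cmod (F (of_real x)) \<le> (c * line_energy f + integral {-A..A} (\<lambda>t. (cmod (\<psi> t))\<^sup>2) / c) / 2"
    using \<open>0 < c\<close> by (simp add: mult_left_mono)
qed

text \<open>Pairing \<open>f\<close> with the truncated conjugate of its own derivative gives an entire function that is
  bounded on the line, so Cauchy's estimate applies to it and yields an \<open>L\<^sup>2\<close> bound.\<close>
lemma line_energy_higher_deriv_bound:
  assumes f: "f \<in> PW2" and "0 < r"
  shows "integrable lborel (\<lambda>x. (cmod ((deriv ^^ n) f (of_real x)))\<^sup>2)" (is ?int)
    and "line_energy ((deriv ^^ n) f) \<le> (fact n * exp (pi * r) / r ^ n)\<^sup>2 * line_energy f" (is ?le)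
proof -
  \<comment> \<open>Cauchy's constant on the circle of radius \<open>r\<close> for a function
    bounded by \<open>exp (pi * |Im z|)\<close>. The radius stays free because Bernstein's
    inequality uses all radii.\<close>
  define K where "K = fact n * exp (pi * r) / r ^ n"
  have "K > 0" using \<open>0 < r\<close> by (simp add: K_def)
  define g where "g = (deriv ^^ n) f"
  have hol: "f holomorphic_on UNIV" by (rule PW2_D(2)[OF f])
  have holg: "g holomorphic_on UNIV" unfolding g_def by (intro holomorphic_higher_deriv hol) auto
  note cg = holomorphic_on_line(1)[OF holg]
  have bound: "integral {-A..A} (\<lambda>t. (cmod (g (of_real t)))\<^sup>2) \<le> K\<^sup>2 * line_energy f" if "A > 0" for A
  proof -
    define \<psi> where "\<psi> = (\<lambda>t. cnj (g (of_real t)))"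
    define X where "X = integral {-A..A} (\<lambda>t. (cmod (g (of_real t)))\<^sup>2)"
    have \<psi>: "continuous_on {-A..A} \<psi>" unfolding \<psi>_def by (intro continuous_intros cg)
    define F where "F = (\<lambda>z. integral {-A..A} (\<lambda>t. f (z + of_real t) * \<psi> t))"
    have norm_\<psi>: "integral {-A..A} (\<lambda>t. (cmod (\<psi> t))\<^sup>2) = X" by (simp add: \<psi>_def X_def)
    \<comment> \<open>The weight \<open>c = K\<close> turns Cauchy's estimate into
      \<open>X \<le> (K\<^sup>2 * line_energy f + X) / 2\<close>. Since the truncated energy
      \<open>X\<close> is finite, it can be absorbed on the left, and the bound no longer depends on
      \<open>A\<close>.\<close>
    define M where "M = (K * line_energy f + X / K) / 2"
    have "0 \<le> X" unfolding X_def by (intro integral_nonneg integrable_continuous_real continuous_intros cg) auto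
    hence "0 \<le> M" using \<open>K > 0\<close> line_energy_nonneg[of f] by (simp add: M_def)
    have F_bound: "cmod (F z) \<le> M * exp (pi * \<bar>Im z\<bar>)" for z
      using pairing_bound[OF f \<psi> \<open>A > 0\<close> \<open>K > 0\<close>, of z] by (simp add: F_def M_def norm_\<psi>)
    have holF: "F holomorphic_on UNIV"
      using pairing_has_field_derivative[OF hol \<psi>]
      unfolding F_def by (auto simp: holomorphic_on_def field_differentiable_def intro: has_field_derivative_at_within)
    \<comment> \<open>All derivatives fall on \<open>f\<close>, where they meet the conjugate of the
      same derivative stored in \<psi>.\<close>
    have "(deriv ^^ n) F 0 = integral {-A..A} (\<lambda>t. g (of_real t) * \<psi> t)"
      unfolding F_def higher_deriv_pairing[OF hol \<psi>] by (simp add: g_def)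
    also have "\<dots> = integral {-A..A} (\<lambda>t. of_real ((cmod (g (of_real t)))\<^sup>2))"
      by (simp add: \<psi>_def complex_norm_square del: of_real_power)
    also have "\<dots> = of_real X"
    proof -
      have "((\<lambda>t. (cmod (g (of_real t)))\<^sup>2) has_integral X) {-A..A}"
        unfolding X_def by (intro integrable_integral integrable_continuous_real continuous_intros cg)
      thus ?thesis by (intro integral_unique has_integral_of_real)
    qed
    finally have "X = cmod ((deriv ^^ n) F 0)" using \<open>0 \<le> X\<close> by simp
    also have "\<dots> \<le> fact n * (M * exp (pi * r)) / r ^ n"
    proof (rule Cauchy_inequality)
      fix x :: complex assume "norm (0 - x) = r"
      hence "\<bar>Im x\<bar> \<le> r" using abs_Im_le_cmod[of x] by simp
      hence "M * exp (pi * \<bar>Im x\<bar>) \<le> M * exp (pi * r)" using \<open>0 \<le> M\<close> by (intro mult_left_mono) auto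
      thus "norm (F x) \<le> M * exp (pi * r)" using F_bound[of x] by linarith
    qed (use \<open>0 < r\<close> holF holomorphic_on_imp_continuous_on in \<open>auto intro: holomorphic_on_subset continuous_on_subset\<close>)
    also have "\<dots> = K * M" by (simp add: K_def)
    also have "\<dots> = (K\<^sup>2 * line_energy f + X) / 2"
      using \<open>K > 0\<close> by (simp add: M_def power2_eq_square field_simps)
    finally show ?thesis unfolding X_def[symmetric] by simp
  qed
  have c: "continuous_on UNIV (\<lambda>t::real. (cmod (g (of_real t)))\<^sup>2)" by (intro continuous_intros cg)
  from integrable_lborel_of_bounded_truncations[OF c _ bound]
  show ?int ?le by (auto simp: g_def K_def line_energy_def)
qed

section \<open>Closure of the Paley-Wiener space under derivatives and linear combinations\<close>

lemma PW2_deriv: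
  assumes f: "f \<in> PW2"
  shows "deriv f \<in> PW2"
proof -
  have hol: "f holomorphic_on UNIV" by (rule PW2_D(2)[OF f])
  have "\<exists>C>0. \<forall>z. cmod (deriv f z) \<le> C * exp ((pi + \<epsilon>) * cmod z)" if "\<epsilon> > 0" for \<epsilon>
  proof -
    obtain C where C: "C > 0" "\<And>z. cmod (f z) \<le> C * exp ((pi + \<epsilon>) * cmod z)"
      using PW2_D(1)[OF f] \<open>\<epsilon> > 0\<close> unfolding exponential_type_le_def by blast
    have "cmod ((deriv ^^ 1) f z) \<le> fact 1 * (C * exp ((pi + \<epsilon>) * (cmod z + 1))) / 1 ^ 1" for z
    proof (rule Cauchy_inequality)
      fix x assume "norm (z - x) = 1"
      hence "cmod x \<le> cmod z + 1" using norm_triangle_ineq2[of x z] by (simp add: norm_minus_commute)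
      hence "C * exp ((pi + \<epsilon>) * cmod x) \<le> C * exp ((pi + \<epsilon>) * (cmod z + 1))"
        using C(1) that by (simp add: add_pos_pos)
      thus "norm (f x) \<le> C * exp ((pi + \<epsilon>) * (cmod z + 1))" using C(2)[of x] by linarith
    qed (use hol holomorphic_on_imp_continuous_on in \<open>auto intro: holomorphic_on_subset continuous_on_subset\<close>)
    hence "cmod (deriv f z) \<le> (C * exp (pi + \<epsilon>)) * exp ((pi + \<epsilon>) * cmod z)" for z
      by (simp add: distrib_left exp_add mult_ac)
    moreover have "0 < C * exp (pi + \<epsilon>)" using C by simp
    ultimately show ?thesis by blast
  qed
  moreover have "integrable lborel (\<lambda>x. (cmod (deriv f (of_real x)))\<^sup>2)"
    using line_energy_higher_deriv_bound(1)[OF f, of 1 1] by simp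
  ultimately show ?thesis using hol by (auto simp: PW2_def exponential_type_le_def intro: holomorphic_deriv)
qed

lemma PW2_higher_deriv: "f \<in> PW2 \<Longrightarrow> (deriv ^^ n) f \<in> PW2"
  by (induction n) (auto intro: PW2_deriv)

lemma PW2_cmult:
  assumes f: "f \<in> PW2"
  shows "(\<lambda>z. c * f z) \<in> PW2"
proof -
  have "\<exists>C>0. \<forall>z. cmod (c * f z) \<le> C * exp ((pi + \<epsilon>) * cmod z)" if "\<epsilon> > 0" for \<epsilon>
  proof -
    obtain C where C: "C > 0" "\<And>z. cmod (f z) \<le> C * exp ((pi + \<epsilon>) * cmod z)"
      using PW2_D(1)[OF f] \<open>\<epsilon> > 0\<close> unfolding exponential_type_le_def by blast
    have "cmod (c * f z) \<le> ((cmod c + 1) * C) * exp ((pi + \<epsilon>) * cmod z)" for z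
      using mult_mono[of "cmod c" "cmod c + 1" "cmod (f z)" "C * exp ((pi + \<epsilon>) * cmod z)"] C
      by (simp add: norm_mult mult.assoc)
    moreover have "0 < (cmod c + 1) * C" using C by (simp add: add_nonneg_pos)
    ultimately show ?thesis by blast
  qed
  thus ?thesis using PW2_D[OF f]
    by (auto simp: PW2_def exponential_type_le_def norm_mult power_mult_distrib intro!: holomorphic_intros)
qed

lemma PW2_add:
  assumes f: "f \<in> PW2" and g: "g \<in> PW2"
  shows "(\<lambda>z. f z + g z) \<in> PW2"
proof -
  note fD = PW2_D[OF f] and gD = PW2_D[OF g]
  have "\<exists>C>0. \<forall>z. cmod (f z + g z) \<le> C * exp ((pi + \<epsilon>) * cmod z)" if "\<epsilon> > 0" for \<epsilon>
  proof -
    obtain C where C: "C > 0" "\<And>z. cmod (f z) \<le> C * exp ((pi + \<epsilon>) * cmod z)"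
      using fD(1) \<open>\<epsilon> > 0\<close> unfolding exponential_type_le_def by blast
    obtain C' where C': "C' > 0" "\<And>z. cmod (g z) \<le> C' * exp ((pi + \<epsilon>) * cmod z)"
      using gD(1) \<open>\<epsilon> > 0\<close> unfolding exponential_type_le_def by blast
    have "cmod (f z + g z) \<le> (C + C') * exp ((pi + \<epsilon>) * cmod z)" for z
      using C(2)[of z] C'(2)[of z] norm_triangle_ineq[of "f z" "g z"] by (simp add: distrib_right)
    thus ?thesis using C C' by (metis add_pos_pos)
  qed
  moreover have "integrable lborel (\<lambda>x. (cmod (f (of_real x) + g (of_real x)))\<^sup>2)"
  proof (rule Bochner_Integration.integrable_bound)
    show "integrable lborel (\<lambda>x. 2 * (cmod (f (of_real x)))\<^sup>2 + 2 * (cmod (g (of_real x)))\<^sup>2)"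
      using fD(3) gD(3) by simp
    have "(cmod (u + v))\<^sup>2 \<le> 2 * (cmod u)\<^sup>2 + 2 * (cmod v)\<^sup>2" for u v
    proof -
      have "(cmod (u + v))\<^sup>2 \<le> (cmod u + cmod v)\<^sup>2" by (intro power_mono norm_triangle_ineq) auto
      also have "\<dots> \<le> 2 * (cmod u)\<^sup>2 + 2 * (cmod v)\<^sup>2"
        using sum_squares_bound[of "cmod u" "cmod v"] by (simp add: power2_sum)
      finally show ?thesis .
    qed
    thus "AE x in lborel. norm ((cmod (f (of_real x) + g (of_real x)))\<^sup>2)
      \<le> norm (2 * (cmod (f (of_real x)))\<^sup>2 + 2 * (cmod (g (of_real x)))\<^sup>2)" by simp
  qed (use holomorphic_on_line(2)[OF fD(2)] holomorphic_on_line(2)[OF gD(2)] in measurable)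
  ultimately show ?thesis using fD gD
    by (auto simp: PW2_def exponential_type_le_def intro!: holomorphic_intros)
qed

section \<open>Completely monotone moments\<close>

lemma sum_binomial_Suc:
  fixes X :: "nat \<Rightarrow> real"
  shows "(\<Sum>j\<le>Suc N. real (Suc N choose j) * X j) =
         (\<Sum>j\<le>N. real (N choose j) * X j) + (\<Sum>j\<le>N. real (N choose j) * X (Suc j))"
proof -
  have "(\<Sum>j\<le>N. real (N choose j) * X j) = (\<Sum>j\<le>Suc N. real (N choose j) * X j)" by simp
  also have "\<dots> = X 0 + (\<Sum>j\<le>N. real (N choose Suc j) * X (Suc j))"
    by (subst sum.atMost_Suc_shift) simp
  finally show ?thesis
    by (subst sum.atMost_Suc_shift) (simp add: distrib_right sum.distrib)
qed

text \<open>The model is \<open>D k r\<close> as the integral of \<open>x ^ r * (1 - x) ^ k\<close>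
  against a measure on [0,1]; the expansion then inserts 1 as the n-th power of
  \<open>x + (1 - x)\<close>.\<close>

lemma difference_table_expansion:
  fixes D :: "nat \<Rightarrow> nat \<Rightarrow> real"
  assumes step: "\<And>k r. D (Suc k) r = D k r - D k (Suc r)"
  shows "D k r = (\<Sum>j\<le>n. real (n choose j) * D (k + n - j) (r + j))"
proof (induction n arbitrary: k r)
  case (Suc n)
  have "D k r = D (Suc k) r + D k (Suc r)" by (simp add: step)
  also have "D (Suc k) r = (\<Sum>j\<le>n. real (n choose j) * D (k + Suc n - j) (r + j))"
    by (subst Suc.IH) simp
  also have "D k (Suc r) = (\<Sum>j\<le>n. real (n choose j) * D (k + Suc n - Suc j) (r + Suc j))"
    by (subst Suc.IH) simp
  finally show ?case by (simp only: sum_binomial_Suc[of n "\<lambda>j. D (k + Suc n - j) (r + j)"])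
qed simp

text \<open>For \<open>r \<le> n\<close> this is the quotient of binomials (k over r) / (n over r),
  the coefficient of \<open>x ^ r\<close> in the Bernstein basis of degree \<open>n\<close>.
  Truncated subtraction makes it vanish for \<open>k < r\<close>.\<close>

definition falling_ratio :: "nat \<Rightarrow> nat \<Rightarrow> nat \<Rightarrow> real" where
  "falling_ratio n k r = (\<Prod>i<r. real (k - i) / real (n - i))"

text \<open>This lets the expansions of all moments share the same weights, the binomials (n over
  k).\<close>

lemma binomial_falling_ratio:
  assumes "r \<le> k" "k \<le> n"
  shows "real (n - r choose (k - r)) = real (n choose k) * falling_ratio n k r"
  using assms
proof (induction r)
  case (Suc r)
  have eq: "n - r = Suc (n - Suc r)" "k - r = Suc (k - Suc r)" using Suc.prems by auto
  have "Suc (n - Suc r) * (n - Suc r choose (k - Suc r)) = Suc (k - Suc r) * (n - r choose (k - r))"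
    unfolding eq by (rule Suc_times_binomial[symmetric])
  hence "real (n - r) * real (n - Suc r choose (k - Suc r)) = real (k - r) * real (n - r choose (k - r))"
    unfolding eq by (metis of_nat_mult)
  moreover have "real (n - r) > 0" using Suc.prems by simp
  ultimately have "real (n - Suc r choose (k - Suc r)) = real (k - r) / real (n - r) * real (n - r choose (k - r))"
    by (simp add: field_simps)
  also have "\<dots> = real (n choose k) * falling_ratio n k (Suc r)"
    using Suc by (simp add: falling_ratio_def)
  finally show ?case .
qed (simp add: falling_ratio_def)

lemma falling_ratio_bounds:
  assumes "k \<le> n"
  shows "0 \<le> falling_ratio n k r" "falling_ratio n k r \<le> 1"
  unfolding falling_ratio_def using assms
  by (auto intro!: prod_nonneg prod_le_1 simp: divide_le_eq_1)

text \<open>Replacing a factor \<open>(k - i) / (n - i)\<close> by \<open>k / n\<close> costs at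
  most \<open>N / (n - N)\<close>, and for factors in [0,1] these costs merely add up along the
  product.\<close>

lemma falling_ratio_power_diff:
  assumes "k \<le> n" "N < n" "r \<le> N"
  shows "\<bar>falling_ratio n k r - (real k / real n) ^ r\<bar> \<le> real r * (real N / real (n - N))"
  using \<open>r \<le> N\<close>
proof (induction r)
  case (Suc r)
  define x where "x = real k / real n"
  define y where "y = real (k - r) / real (n - r)"
  define e where "e = real N / real (n - N)"
  have rn: "r < n" "r \<le> N" using Suc.prems assms by auto
  have x: "0 \<le> x" "x \<le> 1" using assms by (auto simp: x_def)
  have re: "real r / real (n - r) \<le> e"
    unfolding e_def using rn assms by (intro frac_le) auto
  have yx: "\<bar>y - x\<bar> \<le> e"
  proof (cases "r \<le> k")
    case True
    define q where "q = real r / real (n - r)"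
    have "x - y = q * (1 - x)"
      using True rn assms by (simp add: q_def x_def y_def of_nat_diff field_simps)
    moreover have "q * (1 - x) \<le> q * 1"
      using x by (intro mult_left_mono) (auto simp: q_def)
    moreover have "0 \<le> q * (1 - x)" using x by (simp add: q_def)
    ultimately show ?thesis using re unfolding q_def[symmetric] by linarith
  next
    \<comment> \<open>Here the truncated factor is 0, and \<open>k / n\<close> is itself small
      because \<open>k < r\<close>.\<close>
    case False
    have "x \<le> real r / real (n - r)"
      unfolding x_def using False rn assms by (intro frac_le) auto
    thus ?thesis using False re x by (simp add: y_def)
  qed
  have "falling_ratio n k (Suc r) - x ^ Suc r
        = falling_ratio n k r * (y - x) + x * (falling_ratio n k r - x ^ r)"
    by (simp add: falling_ratio_def y_def algebra_simps)
  also have "\<bar>\<dots>\<bar> \<le> \<bar>falling_ratio n k r\<bar> * \<bar>y - x\<bar> + \<bar>x\<bar> * \<bar>falling_ratio n k r - x ^ r\<bar>"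
    by (metis abs_mult abs_triangle_ineq)
  also have "\<dots> \<le> 1 * e + 1 * (real r * e)"
    using Suc.IH rn yx x falling_ratio_bounds[OF \<open>k \<le> n\<close>, of r]
    by (intro add_mono mult_mono) (auto simp: x_def e_def)
  finally show ?case by (simp add: x_def e_def distrib_right add_divide_distrib)
qed (simp add: falling_ratio_def)

text \<open>Expanding the moments \<open>D 0 r\<close> in the Bernstein-type basis of level \<open>n\<close> turns the coefficients of
  the polynomial into perturbations of its values at the points \<open>k / n\<close>, so for large \<open>n\<close> they are positive.\<close>
lemma positive_polynomial_completely_monotone:
  fixes a :: "nat \<Rightarrow> real" and N :: nat
  assumes pos: "\<And>x. x \<in> {0..1} \<Longrightarrow> 0 < (\<Sum>r=0..N. a r * x ^ r)"
  obtains \<epsilon> where "\<epsilon> > 0"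
    and "\<And>D :: nat \<Rightarrow> nat \<Rightarrow> real. (\<And>k r. D (Suc k) r = D k r - D k (Suc r)) \<Longrightarrow> (\<And>k r. 0 \<le> D k r)
           \<Longrightarrow> \<epsilon> * D 0 0 \<le> (\<Sum>r=0..N. a r * D 0 r)"
proof -
  define P where "P = (\<lambda>x::real. \<Sum>r=0..N. a r * x ^ r)"
  have "continuous_on {0..1} P" unfolding P_def by (intro continuous_intros)
  then obtain x0 where x0: "x0 \<in> {0..1}" "\<And>x. x \<in> {0..1} \<Longrightarrow> P x0 \<le> P x"
    using continuous_attains_inf[of "{0..1::real}" P] by auto
  \<comment> \<open>Half the minimum of \<open>P\<close> is kept; the other half pays for the
    perturbation of the coefficients.\<close>
  define \<epsilon> where "\<epsilon> = P x0 / 2"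
  have "\<epsilon> > 0" using pos x0(1) by (simp add: \<epsilon>_def P_def)
  define A where "A = (\<Sum>r=0..N. \<bar>a r\<bar>)"
  have A: "0 \<le> A" unfolding A_def by (simp add: sum_nonneg)
  obtain K :: nat where K: "A * real N * real N / \<epsilon> < real K" using reals_Archimedean2 by blast
  \<comment> \<open>Then \<open>n - N\<close> is \<open>Suc K\<close>, the denominator in the
    perturbation bound, and \<open>K\<close> was chosen to push that bound below \<epsilon>.\<close>
  define n where "n = N + Suc K"
  have coeff: "\<epsilon> \<le> (\<Sum>r=0..N. a r * falling_ratio n k r)" if "k \<le> n" for k
  proof -
    define x where "x = real k / real n"
    have "x \<in> {0..1}" using that by (auto simp: x_def n_def)
    hence "2 * \<epsilon> \<le> P x" using x0(2) by (simp add: \<epsilon>_def)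
    moreover have "\<bar>P x - (\<Sum>r=0..N. a r * falling_ratio n k r)\<bar> \<le> \<epsilon>"
    proof -
      have "P x - (\<Sum>r=0..N. a r * falling_ratio n k r) = (\<Sum>r=0..N. a r * (x ^ r - falling_ratio n k r))"
        by (simp add: P_def algebra_simps sum_subtractf)
      also have "\<bar>\<dots>\<bar> \<le> (\<Sum>r=0..N. \<bar>a r\<bar> * (real N * (real N / real (Suc K))))"
      proof (rule order_trans[OF sum_abs], rule sum_mono)
        fix r assume "r \<in> {0..N}"
        hence "\<bar>falling_ratio n k r - x ^ r\<bar> \<le> real r * (real N / real (Suc K))"
          using falling_ratio_power_diff[of k n N r] that by (simp add: x_def n_def)
        also have "\<dots> \<le> real N * (real N / real (Suc K))"
          using \<open>r \<in> {0..N}\<close> by (intro mult_right_mono) auto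
        finally show "\<bar>a r * (x ^ r - falling_ratio n k r)\<bar> \<le> \<bar>a r\<bar> * (real N * (real N / real (Suc K)))"
          unfolding abs_mult by (intro mult_left_mono) (auto simp: abs_minus_commute)
      qed
      also have "\<dots> = A * real N * real N / real (Suc K)"
        unfolding sum_distrib_right[symmetric] A_def by simp
      also have "\<dots> \<le> \<epsilon>"
        using K \<open>\<epsilon> > 0\<close> by (simp add: field_simps)
      finally show ?thesis .
    qed
    ultimately show ?thesis by linarith
  qed
  have "\<epsilon> * D 0 0 \<le> (\<Sum>r=0..N. a r * D 0 r)"
    if step: "\<And>k r. D (Suc k) r = D k r - D k (Suc r)" and nonneg: "\<And>k r. 0 \<le> D k r"
    for D :: "nat \<Rightarrow> nat \<Rightarrow> real"
  proof -
    \<comment> \<open>These are the masses of the Bernstein basis functions: nonnegative, and the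
      same for every moment \<open>D 0 r\<close>.\<close>
    define W where "W = (\<lambda>k. real (n choose k) * D (n - k) k)"
    have expand: "D 0 r = (\<Sum>k\<le>n. falling_ratio n k r * W k)" if "r \<le> N" for r
    proof -
      have rn: "r \<le> n" using that by (simp add: n_def)
      have "D 0 r = (\<Sum>j\<le>n - r. real (n - r choose j) * D (n - r - j) (r + j))"
        using difference_table_expansion[of D 0 r "n - r", OF step] by simp
      also have "\<dots> = (\<Sum>k\<in>{r..n}. real (n - r choose (k - r)) * D (n - k) k)"
        by (rule sum.reindex_bij_witness[of _ "\<lambda>k. k - r" "\<lambda>j. r + j"]) (use rn in auto)
      also have "\<dots> = (\<Sum>k\<in>{r..n}. falling_ratio n k r * W k)"
        by (intro sum.cong) (auto simp: binomial_falling_ratio W_def)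
      also have "\<dots> = (\<Sum>k\<le>n. falling_ratio n k r * W k)"
      proof (rule sum.mono_neutral_left)
        show "\<forall>k\<in>{..n} - {r..n}. falling_ratio n k r * W k = 0"
          by (auto simp: falling_ratio_def intro!: prod_zero)
      qed auto
      finally show ?thesis .
    qed
    have "\<epsilon> * D 0 0 = (\<Sum>k\<le>n. \<epsilon> * W k)"
      by (simp add: expand falling_ratio_def sum_distrib_left)
    also have "\<dots> \<le> (\<Sum>k\<le>n. (\<Sum>r=0..N. a r * falling_ratio n k r) * W k)"
      using coeff by (intro sum_mono mult_right_mono) (auto simp: W_def nonneg)
    also have "\<dots> = (\<Sum>r=0..N. a r * (\<Sum>k\<le>n. falling_ratio n k r * W k))"
      unfolding sum_distrib_left sum_distrib_right by (subst sum.swap) (simp add: mult.assoc)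
    also have "\<dots> = (\<Sum>r=0..N. a r * D 0 r)"
      by (intro sum.cong) (auto simp: expand)
    finally show ?thesis .
  qed
  thus thesis using that \<open>\<epsilon> > 0\<close> by blast
qed

section \<open>Bernstein's inequality and positivity of the energy form\<close>

lemma integral_by_parts_line:
  fixes U V u v :: "real \<Rightarrow> complex"
  assumes dU: "\<And>x. (U has_vector_derivative u x) (at x)" and dV: "\<And>x. (V has_vector_derivative v x) (at x)"
    and cu: "continuous_on UNIV u" and cv: "continuous_on UNIV v"
    and sq: "integrable lborel (\<lambda>x. (cmod (U x))\<^sup>2)" "integrable lborel (\<lambda>x. (cmod (u x))\<^sup>2)"
      "integrable lborel (\<lambda>x. (cmod (V x))\<^sup>2)" "integrable lborel (\<lambda>x. (cmod (v x))\<^sup>2)"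
  shows "(LINT x|lborel. u x * V x) = - (LINT x|lborel. U x * v x)"
proof -
  have cU: "continuous_on UNIV U" and cV: "continuous_on UNIV V"
    using dU dV by (auto intro!: continuous_at_imp_continuous_on has_vector_derivative_continuous)
  note m = cU[THEN borel_measurable_continuous_onI] cV[THEN borel_measurable_continuous_onI]
    cu[THEN borel_measurable_continuous_onI] cv[THEN borel_measurable_continuous_onI]
  have i1: "integrable lborel (\<lambda>x. u x * V x)" by (intro square_integrable_mult) (use m sq in auto)
  have i2: "integrable lborel (\<lambda>x. U x * v x)" by (intro square_integrable_mult) (use m sq in auto)
  have i3: "integrable lborel (\<lambda>x. U x * V x)" by (intro square_integrable_mult) (use m sq in auto)
  have "(LINT x|lborel. U x * v x + u x * V x) = 0"
  proof (rule integral_derivative_eq_0[OF _ _ i3])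
    show "((\<lambda>x. U x * V x) has_vector_derivative U x * v x + u x * V x) (at x)" for x
      by (rule has_vector_derivative_mult[OF dU dV])
  qed (use i1 i2 cu cv cU cV in \<open>auto intro!: continuous_intros\<close>)
  thus ?thesis using i1 i2 by (simp add: eq_neg_iff_add_eq_0 add.commute)
qed

lemma PW2_integrable_mult:
  assumes "f \<in> PW2" "g \<in> PW2"
  shows "integrable lborel (\<lambda>x. f (of_real x) * g (of_real x))"
    and "integrable lborel (\<lambda>x. f (of_real x) * cnj (g (of_real x)))"
proof -
  note D = PW2_D[OF assms(1)] PW2_D[OF assms(2)]
  have "(\<lambda>x::real. cnj (g (of_real x))) \<in> borel_measurable lborel"
    using borel_measurable_continuous_onI[OF continuous_on_cnj[OF holomorphic_on_line(1)[OF D(5)]]] by simp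
  with D show "integrable lborel (\<lambda>x. f (of_real x) * cnj (g (of_real x)))"
    by (intro square_integrable_mult[OF holomorphic_on_line(2)[OF D(2)]]) auto
  from D show "integrable lborel (\<lambda>x. f (of_real x) * g (of_real x))"
    by (intro square_integrable_mult holomorphic_on_line(2)) auto
qed

lemma PW2_integral_by_parts:
  assumes f: "f \<in> PW2" and g: "g \<in> PW2"
  shows "(LINT x|lborel. deriv f (of_real x) * g (of_real x)) = - (LINT x|lborel. f (of_real x) * deriv g (of_real x))"
  using PW2_D[OF f] PW2_D[OF g] PW2_D[OF PW2_deriv[OF f]] PW2_D[OF PW2_deriv[OF g]]
  by (intro integral_by_parts_line holomorphic_on_line) auto

lemma PW2_integral_by_parts_higher:
  assumes f: "f \<in> PW2" and g: "g \<in> PW2"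
  shows "(LINT x|lborel. (deriv ^^ n) f (of_real x) * (deriv ^^ m) g (of_real x))
         = (-1) ^ n * (LINT x|lborel. f (of_real x) * (deriv ^^ (n + m)) g (of_real x))"
proof (induction n arbitrary: m)
  case (Suc n)
  have "(LINT x|lborel. (deriv ^^ Suc n) f (of_real x) * (deriv ^^ m) g (of_real x))
        = - (LINT x|lborel. (deriv ^^ n) f (of_real x) * (deriv ^^ Suc m) g (of_real x))"
    using PW2_integral_by_parts[OF PW2_higher_deriv[OF f] PW2_higher_deriv[OF g]] by simp
  thus ?case by (simp only: Suc.IH) simp
qed simp

lemma integral_mult_cnj_self:
  "(LINT x|lborel. f (of_real x) * cnj (f (of_real x))) = of_real (line_energy f)"
  unfolding line_energy_def integral_complex_of_real[symmetric]
  by (simp add: complex_norm_square del: of_real_power)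

lemma line_energy_deriv:
  assumes f: "f \<in> PW2"
  shows "(LINT x|lborel. f (of_real x) * cnj (deriv (deriv f) (of_real x))) = - of_real (line_energy (deriv f))"
proof -
  let ?d = "deriv f" and ?dd = "deriv (deriv f)"
  have d: "?d \<in> PW2" and dd: "?dd \<in> PW2" using f by (auto intro: PW2_deriv)
  have "(LINT x|lborel. ?d (of_real x) * cnj (?d (of_real x))) = - (LINT x|lborel. f (of_real x) * cnj (?dd (of_real x)))"
    using PW2_D[OF f] PW2_D[OF d] PW2_D[OF dd]
    by (intro integral_by_parts_line holomorphic_on_line has_vector_derivative_cnj continuous_intros) auto
  thus ?thesis by (simp add: integral_mult_cnj_self)
qed

text \<open>Integration by parts pairs \<open>f\<close> with its second derivative. The
  Cauchy-Schwarz bound is kept in linearised form, with a weight \<open>q\<close> that will be the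
  first energy ratio.\<close>

lemma line_energy_deriv_log_convex:
  assumes f: "f \<in> PW2" and "0 < q"
  shows "2 * line_energy (deriv f) \<le> q * line_energy f + line_energy (deriv (deriv f)) / q"
proof -
  let ?dd = "deriv (deriv f)"
  have dd: "?dd \<in> PW2" using f by (auto intro: PW2_deriv)
  note sq = PW2_D(3)[OF f] PW2_D(3)[OF dd]
  have "line_energy (deriv f) = cmod (LINT x|lborel. f (of_real x) * cnj (?dd (of_real x)))"
    using line_energy_deriv[OF f] line_energy_nonneg[of "deriv f"] by simp
  also have "\<dots> \<le> (LINT x|lborel. cmod (f (of_real x) * cnj (?dd (of_real x))))" by (rule integral_norm_bound)
  also have "\<dots> \<le> (LINT x|lborel. q / 2 * (cmod (f (of_real x)))\<^sup>2 + 1 / (2 * q) * (cmod (?dd (of_real x)))\<^sup>2)"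
  proof (rule integral_mono)
    fix x :: real
    define u v where "u = cmod (f (of_real x))" and "v = cmod (?dd (of_real x))"
    have "0 \<le> (q * u - v)\<^sup>2" by simp
    hence "2 * q * (u * v) \<le> q * (q * u\<^sup>2) + v\<^sup>2" by (simp add: power2_eq_square algebra_simps)
    hence "u * v \<le> q / 2 * u\<^sup>2 + 1 / (2 * q) * v\<^sup>2" using \<open>0 < q\<close> by (simp add: field_simps)
    thus "cmod (f (of_real x) * cnj (?dd (of_real x)))
          \<le> q / 2 * (cmod (f (of_real x)))\<^sup>2 + 1 / (2 * q) * (cmod (?dd (of_real x)))\<^sup>2"
      by (simp add: u_def v_def norm_mult)
  qed (use sq PW2_integrable_mult(2)[OF f dd] in \<open>auto intro: integrable_norm\<close>)
  also have "\<dots> = q / 2 * line_energy f + 1 / (2 * q) * line_energy ?dd"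
    using sq by (simp add: line_energy_def)
  finally show ?thesis using \<open>0 < q\<close> by (simp add: field_simps)
qed

text \<open>Weighting the bounds by \<open>\<theta> ^ n\<close> and summing the exponential series
  gives \<open>exp (\<theta> * p * r) \<le> exp (\<tau> * r) / (1 - \<theta>)\<close>, which fails
  for large \<open>r\<close> once \<open>\<theta> * p\<close> exceeds \<tau>.\<close>

lemma exponential_rate_le:
  fixes p \<tau> :: real
  assumes "0 < \<tau>" and bound: "\<And>n r. 0 < r \<Longrightarrow> (p * r) ^ n \<le> fact n * exp (\<tau> * r)"
  shows "p \<le> \<tau>"
proof (rule ccontr)
  assume "\<not> p \<le> \<tau>"
  hence p: "\<tau> < p" "0 < p" using assms by auto
  \<comment> \<open>Chosen so that \<open>\<theta> * p\<close> is the midpoint of \<tau> and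
    \<open>p\<close>; \<open>s\<close> is half their gap.\<close>
  define \<theta> where "\<theta> = (\<tau> + p) / (2 * p)"
  define s where "s = (p - \<tau>) / 2"
  have \<theta>: "0 < \<theta>" "\<theta> < 1" and s: "0 < s" "\<theta> * p = \<tau> + s"
    using p \<open>0 < \<tau>\<close> by (auto simp: \<theta>_def s_def field_simps)
  \<comment> \<open>With \<open>s * r = 1 / (1 - \<theta>)\<close> the contradiction is just
    \<open>exp x \<ge> 1 + x\<close>.\<close>
  define r where "r = 1 / (1 - \<theta>) / s"
  have "0 < r" using \<theta> s by (simp add: r_def)
  have "exp (\<theta> * p * r) \<le> 1 / (1 - \<theta>) * exp (\<tau> * r)"
  proof (rule sums_le)
    show "(\<lambda>n. (\<theta> * p * r) ^ n /\<^sub>R fact n) sums exp (\<theta> * p * r)" by (rule exp_converges)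
    show "(\<lambda>n. \<theta> ^ n * exp (\<tau> * r)) sums (1 / (1 - \<theta>) * exp (\<tau> * r))"
      using \<theta> by (intro sums_mult2 geometric_sums) auto
    fix n
    have "(p * r) ^ n / fact n \<le> exp (\<tau> * r)"
      using bound[OF \<open>0 < r\<close>, of n] by (simp add: field_simps)
    hence "\<theta> ^ n * ((p * r) ^ n / fact n) \<le> \<theta> ^ n * exp (\<tau> * r)"
      using \<theta> by (intro mult_left_mono) auto
    thus "(\<theta> * p * r) ^ n /\<^sub>R fact n \<le> \<theta> ^ n * exp (\<tau> * r)"
      by (simp add: power_mult_distrib divide_inverse mult_ac)
  qed
  hence "exp (\<tau> * r) * exp (s * r) \<le> exp (\<tau> * r) * (1 / (1 - \<theta>))"
    by (simp add: s(2) distrib_right exp_add)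
  hence "exp (s * r) \<le> 1 / (1 - \<theta>)" by (rule mult_left_le_imp_le) simp
  moreover have "s * r = 1 / (1 - \<theta>)" using s by (simp add: r_def)
  ultimately show False using exp_ge_add_one_self[of "s * r"] by linarith
qed

text \<open>Bernstein's inequality: the energies of successive derivatives are log-convex, so a first ratio
  above \<open>pi\<^sup>2\<close> would force faster growth than the exponential type permits.\<close>
lemma line_energy_deriv_le:
  assumes f: "f \<in> PW2"
  shows "line_energy (deriv f) \<le> pi\<^sup>2 * line_energy f"
proof (cases "line_energy f = 0")
  case True
  have "line_energy (deriv f) \<le> 0"
    using line_energy_higher_deriv_bound(2)[OF f, of 1 1] by (simp add: True)
  thus ?thesis by (simp add: True)
next
  case False
  define e where "e = (\<lambda>n. line_energy ((deriv ^^ n) f))"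
  have e0: "0 < e 0" using False line_energy_nonneg[of f] by (simp add: e_def)
  define q where "q = e 1 / e 0"
  have "0 \<le> e n" for n by (simp add: e_def line_energy_nonneg)
  hence "0 \<le> q" by (simp add: q_def)
  have conv: "2 * e (Suc n) \<le> q * e n + e (Suc (Suc n)) / q" if "0 < q" for n
    using line_energy_deriv_log_convex[OF PW2_higher_deriv[OF f] that, of n] by (simp add: e_def)
  \<comment> \<open>Convexity with weight \<open>q\<close> propagates the first ratio: if
    \<open>q * e n\<close> is at most \<open>e (Suc n)\<close>, it cancels one of the two copies of
    \<open>e (Suc n)\<close> on the left of \<open>conv\<close>.\<close>
  have step: "q * e n \<le> e (Suc n)" for n
  proof (cases "q = 0")
    case True
    thus ?thesis by (simp add: e_def line_energy_nonneg)
  next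
    case False
    hence "0 < q" using \<open>0 \<le> q\<close> by simp
    show ?thesis
    proof (induction n)
      case 0
      thus ?case using e0 by (simp add: q_def)
    next
      case (Suc n)
      have "e (Suc n) \<le> e (Suc (Suc n)) / q" using conv[OF \<open>0 < q\<close>, of n] Suc by linarith
      thus ?case using \<open>0 < q\<close> by (simp add: field_simps)
    qed
  qed
  have growth: "q ^ n * e 0 \<le> e n" for n
  proof (induction n)
    case (Suc n)
    have "q ^ Suc n * e 0 \<le> q * e n" using mult_left_mono[OF Suc \<open>0 \<le> q\<close>] by (simp add: mult_ac)
    thus ?case using step[of n] by linarith
  qed simp
  have "sqrt q \<le> pi"
  proof (rule exponential_rate_le)
    fix n and r :: real assume "0 < r"
    have "q ^ n * e 0 \<le> (fact n * exp (pi * r) / r ^ n)\<^sup>2 * e 0"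
      using growth[of n] line_energy_higher_deriv_bound(2)[OF f \<open>0 < r\<close>, of n] by (simp add: e_def)
    hence "(sqrt q ^ n)\<^sup>2 \<le> (fact n * exp (pi * r) / r ^ n)\<^sup>2"
      using e0 \<open>0 \<le> q\<close> by (simp flip: real_sqrt_power)
    hence "sqrt q ^ n \<le> fact n * exp (pi * r) / r ^ n"
      by (rule power2_le_imp_le) (use \<open>0 < r\<close> in auto)
    thus "(sqrt q * r) ^ n \<le> fact n * exp (pi * r)"
      using \<open>0 < r\<close> by (simp add: field_simps power_mult_distrib)
  qed simp
  hence "(sqrt q)\<^sup>2 \<le> pi\<^sup>2" using \<open>0 \<le> q\<close> by (intro power_mono) auto
  hence "e 1 \<le> pi\<^sup>2 * e 0" using \<open>0 \<le> q\<close> e0 by (simp add: q_def field_simps)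
  thus ?thesis by (simp add: e_def)
qed

section \<open>Iterated differences of the normalised energies\<close>

definition scaled_deriv :: "(complex \<Rightarrow> complex) \<Rightarrow> complex \<Rightarrow> complex" where
  "scaled_deriv f = (\<lambda>z. deriv f z / of_real pi)"

lemma scaled_deriv_apply: "scaled_deriv f z = deriv f z / of_real pi"
  by (simp add: scaled_deriv_def)

text \<open>With T = - D^2 / pi^2 this is the operator 1 - T.\<close>

definition add_scaled_deriv2 :: "(complex \<Rightarrow> complex) \<Rightarrow> complex \<Rightarrow> complex" where
  "add_scaled_deriv2 f = (\<lambda>z. f z + scaled_deriv (scaled_deriv f) z)"

text \<open>On \<open>PW2\<close> this is the quadratic form of (1 - T)^k, because the energy of
  \<open>scaled_deriv f\<close> is the form of T at \<open>f\<close>. The recursive encoding uses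
  only energies and makes the difference-table relation hold by definition.\<close>

primrec energy_difference :: "nat \<Rightarrow> (complex \<Rightarrow> complex) \<Rightarrow> real" where
  "energy_difference 0 f = line_energy f"
| "energy_difference (Suc k) f = energy_difference k f - energy_difference k (scaled_deriv f)"

lemma PW2_scaled_deriv: "f \<in> PW2 \<Longrightarrow> scaled_deriv f \<in> PW2"
  unfolding scaled_deriv_def divide_inverse
  using PW2_cmult[OF PW2_deriv, of f "inverse (of_real pi)"] by (simp add: mult.commute)

lemma PW2_add_scaled_deriv2: "f \<in> PW2 \<Longrightarrow> add_scaled_deriv2 f \<in> PW2"
  unfolding add_scaled_deriv2_def by (intro PW2_add PW2_scaled_deriv)

lemma PW2_field_differentiable: "f \<in> PW2 \<Longrightarrow> f field_differentiable at z"
  using PW2_D(2) holomorphic_on_imp_differentiable_at by blast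

lemma line_energy_divide: "line_energy (\<lambda>z. f z / c) = line_energy f / (cmod c)\<^sup>2"
  by (simp add: line_energy_def norm_divide power_divide)

lemma scaled_deriv_power:
  assumes f: "f \<in> PW2"
  shows "(scaled_deriv ^^ n) f = (\<lambda>z. (deriv ^^ n) f z / of_real pi ^ n)"
proof (induction n)
  case (Suc n)
  have "deriv (\<lambda>z. (deriv ^^ n) f z / of_real pi ^ n) z = deriv ((deriv ^^ n) f) z / of_real pi ^ n" for z
    by (intro deriv_cdivide_right PW2_field_differentiable PW2_higher_deriv f)
  thus ?case
    unfolding funpow.simps o_apply Suc.IH by (simp add: scaled_deriv_apply fun_eq_iff mult.commute)
qed simp

lemma scaled_deriv_scaled_deriv:
  "f \<in> PW2 \<Longrightarrow> scaled_deriv (scaled_deriv f) = (\<lambda>z. deriv (deriv f) z / (of_real pi)\<^sup>2)"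
  using scaled_deriv_power[of f 2] by (simp add: numeral_2_eq_2)

lemma scaled_deriv_add_scaled_deriv2:
  assumes f: "f \<in> PW2"
  shows "scaled_deriv (add_scaled_deriv2 f) = add_scaled_deriv2 (scaled_deriv f)"
proof -
  have "deriv (\<lambda>z. f z + scaled_deriv (scaled_deriv f) z) z = deriv f z + deriv (scaled_deriv (scaled_deriv f)) z" for z
    by (intro deriv_add PW2_field_differentiable PW2_scaled_deriv f)
  thus ?thesis
    by (simp add: fun_eq_iff add_scaled_deriv2_def add_divide_distrib
        scaled_deriv_apply[of "\<lambda>z. f z + scaled_deriv (scaled_deriv f) z"]
        scaled_deriv_apply[of f] scaled_deriv_apply[of "scaled_deriv (scaled_deriv f)"])
qed

lemma line_energy_add_scaled_deriv2:
  assumes f: "f \<in> PW2"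
  shows "line_energy (add_scaled_deriv2 f)
         = line_energy f - 2 * line_energy (scaled_deriv f) + line_energy (scaled_deriv (scaled_deriv f))"
proof -
  let ?dd = "deriv (deriv f)"
  have dd: "?dd \<in> PW2" using f by (auto intro: PW2_deriv)
  note int = PW2_D(3)[OF f] PW2_D(3)[OF dd] PW2_integrable_mult(2)[OF f dd]
  have lin: "(LINT x|lborel. A x + c * B x + C x / d) = (LINT x|lborel. A x) + c * (LINT x|lborel. B x) + (LINT x|lborel. C x) / d"
    if "integrable lborel A" "integrable lborel B" "integrable lborel C" for A B C :: "real \<Rightarrow> real" and c d
    using that by simp
  have "(cmod (u + v / (of_real pi)\<^sup>2))\<^sup>2 = (cmod u)\<^sup>2 + 2 / pi\<^sup>2 * Re (u * cnj v) + (cmod v)\<^sup>2 / pi ^ 4" for u v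
    by (simp add: cmod_power2 power2_sum Re_divide_of_real Im_divide_of_real add_divide_distrib power_divide
        flip: of_real_power power_mult)
  hence "line_energy (add_scaled_deriv2 f) = (LINT x|lborel. (cmod (f (of_real x)))\<^sup>2
           + 2 / pi\<^sup>2 * Re (f (of_real x) * cnj (?dd (of_real x))) + (cmod (?dd (of_real x)))\<^sup>2 / pi ^ 4)"
    by (simp add: line_energy_def add_scaled_deriv2_def scaled_deriv_scaled_deriv[OF f])
  also have "\<dots> = line_energy f + 2 / pi\<^sup>2 * Re (LINT x|lborel. f (of_real x) * cnj (?dd (of_real x)))
                + line_energy ?dd / pi ^ 4"
    unfolding lin[OF int(1) integrable_Re[OF int(3)] int(2)] integral_Re[OF int(3)] line_energy_def ..
  also have "\<dots> = line_energy f - 2 * (line_energy (deriv f) / pi\<^sup>2) + line_energy ?dd / pi ^ 4"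
    unfolding line_energy_deriv[OF f] by simp
  also have "line_energy ?dd / pi ^ 4 = line_energy (scaled_deriv (scaled_deriv f))"
    by (simp add: scaled_deriv_scaled_deriv[OF f] line_energy_divide norm_power flip: power_mult)
  also have "line_energy (deriv f) / pi\<^sup>2 = line_energy (scaled_deriv f)"
    by (simp add: scaled_deriv_def line_energy_divide)
  finally show ?thesis .
qed

text \<open>Since 1 - T is symmetric, two of its factors can be split between the two sides of the
  form. The base case is the expansion of one squared norm; the induction uses that 1 - T commutes
  with the scaled derivative.\<close>

lemma energy_difference_Suc_Suc:
  "f \<in> PW2 \<Longrightarrow> energy_difference (Suc (Suc k)) f = energy_difference k (add_scaled_deriv2 f)"
proof (induction k arbitrary: f)
  case 0
  thus ?case by (simp add: line_energy_add_scaled_deriv2)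
next
  case (Suc k)
  have "energy_difference (Suc (Suc (Suc k))) f
        = energy_difference (Suc (Suc k)) f - energy_difference (Suc (Suc k)) (scaled_deriv f)"
    by (rule energy_difference.simps)
  also have "\<dots> = energy_difference (Suc k) (add_scaled_deriv2 f)"
    using Suc.IH[OF Suc.prems] Suc.IH[OF PW2_scaled_deriv[OF Suc.prems]]
    by (simp only: energy_difference.simps scaled_deriv_add_scaled_deriv2[OF Suc.prems])
  finally show ?case .
qed

text \<open>Removing factors in pairs leaves a squared norm when \<open>k\<close> is even and
  Bernstein's inequality when \<open>k\<close> is odd.\<close>

lemma energy_difference_nonneg: "f \<in> PW2 \<Longrightarrow> 0 \<le> energy_difference k f"
proof (induction k arbitrary: f rule: less_induct)
  case (less k)
  consider "k = 0" | "k = 1" | j where "k = Suc (Suc j)"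
    by (metis One_nat_def not0_implies_Suc)
  thus ?case
  proof cases
    case 1
    thus ?thesis by (simp add: line_energy_nonneg)
  next
    case 2
    thus ?thesis using line_energy_deriv_le[OF less.prems]
      by (simp add: scaled_deriv_def line_energy_divide field_simps)
  next
    case 3
    thus ?thesis using less.IH[of j, OF _ PW2_add_scaled_deriv2[OF less.prems]]
      energy_difference_Suc_Suc[OF less.prems, of j] by (simp del: energy_difference.simps)
  qed
qed

lemma energy_form_coercive:
  fixes a :: "nat \<Rightarrow> real" and N :: nat
  assumes pos: "\<And>x. x \<in> {0..1} \<Longrightarrow> 0 < (\<Sum>r=0..N. a r * x ^ r)"
  obtains \<epsilon> where "\<epsilon> > 0"
    and "\<And>f. f \<in> PW2 \<Longrightarrow> \<epsilon> * line_energy f \<le> (\<Sum>n=0..N. a n / pi ^ (2 * n) * line_energy ((deriv ^^ n) f))"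
proof -
  obtain \<epsilon> where \<epsilon>: "\<epsilon> > 0" and le: "\<And>D :: nat \<Rightarrow> nat \<Rightarrow> real. (\<And>k r. D (Suc k) r = D k r - D k (Suc r)) \<Longrightarrow> (\<And>k r. 0 \<le> D k r)
           \<Longrightarrow> \<epsilon> * D 0 0 \<le> (\<Sum>r=0..N. a r * D 0 r)"
    using positive_polynomial_completely_monotone[OF pos] by blast
  have "\<epsilon> * line_energy f \<le> (\<Sum>n=0..N. a n / pi ^ (2 * n) * line_energy ((deriv ^^ n) f))" if f: "f \<in> PW2" for f
  proof -
    have S: "(scaled_deriv ^^ r) f \<in> PW2" for r by (induction r) (auto intro: PW2_scaled_deriv f)
    have "energy_difference 0 ((scaled_deriv ^^ r) f) = line_energy ((deriv ^^ r) f) / pi ^ (2 * r)" for r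
      by (simp add: scaled_deriv_power[OF f] line_energy_divide norm_power mult.commute flip: power_mult)
    \<comment> \<open>The difference table is that of the moments of T at \<open>f\<close>: raising
      \<open>r\<close> applies one more scaled derivative.\<close>
    with le[of "\<lambda>k r. energy_difference k ((scaled_deriv ^^ r) f)"] energy_difference_nonneg[OF S]
    show ?thesis by simp
  qed
  thus thesis using that \<epsilon> by blast
qed

section \<open>Semicircle contours\<close>

text \<open>The derivative \<open>2 * g * g'\<close> of the square of \<open>g\<close> is a product
  of two square-integrable functions, so it is integrable and \<open>g\<close> is bounded on the
  line; the strip bound does the rest.\<close>

lemma PW2_strip_bound:
  assumes g: "g \<in> PW2"
  obtains M where "0 \<le> M" "\<And>z. cmod (g z) \<le> M * exp (pi * \<bar>Im z\<bar>)"
proof -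
  have d: "deriv g \<in> PW2" using g by (rule PW2_deriv)
  note hg = PW2_D(2)[OF g] and hd = PW2_D(2)[OF d]
  define u where "u = (\<lambda>x::real. 2 * (g (of_real x) * deriv g (of_real x)))"
  have "((\<lambda>x. (g (of_real x))\<^sup>2) has_vector_derivative u x) (at x)" for x :: real
    using has_vector_derivative_mult[OF holomorphic_on_line(3)[OF hg] holomorphic_on_line(3)[OF hg], of x]
    by (simp add: u_def power2_eq_square algebra_simps)
  moreover have "continuous_on UNIV u"
    unfolding u_def by (intro continuous_intros holomorphic_on_line hg hd)
  moreover have "integrable lborel u"
    unfolding u_def using PW2_integrable_mult(1)[OF g d] by simp
  ultimately have "cmod ((g (of_real x))\<^sup>2) \<le> cmod ((g (of_real 0))\<^sup>2) + (LINT x|lborel. cmod (u x))" for x :: real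
    by (rule norm_le_integral_norm_derivative)
  then obtain B where B: "\<And>x::real. (cmod (g (of_real x)))\<^sup>2 \<le> B" by (metis norm_power)
  hence "0 \<le> B" using zero_le_power2 order_trans by blast
  have "cmod (g (of_real x)) \<le> sqrt B" for x :: real using B by (simp add: real_le_rsqrt)
  from that[OF _ exponential_type_le_strip_bound[OF PW2_D(1)[OF g] this]] \<open>0 \<le> B\<close>
  show thesis by simp
qed

lemma contour_integral_arc_inverse:
  assumes "0 < R"
  shows "contour_integral (part_circlepath 0 R 0 b) (\<lambda>z. 1 / z) = \<i> * of_real b"
proof -
  have "contour_integral (part_circlepath 0 R 0 b) (\<lambda>z. 1 / z) = integral {0..1::real} (\<lambda>x. \<i> * of_real b)"
    unfolding contour_integral_integral vector_derivative_part_circlepath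
    using assms by (intro Henstock_Kurzweil_Integration.integral_cong) (simp add: part_circlepath_def field_simps)
  thus ?thesis by simp
qed

text \<open>The sign \<sigma> selects the half-plane in which the exponential cancels the growth of
  \<open>G\<close> exactly, so \<open>f z / z\<close> is at most \<open>K / R\<^sup>2\<close> on the
  arc. Subtracting \<open>f 0\<close> removes the singularity at 0, which lies on the
  contour.\<close>

lemma holomorphic_difference_quotient_semicircle:
  fixes \<sigma> \<tau> K R :: real
  assumes hol: "G holomorphic_on UNIV"
    and growth: "\<And>z. z \<noteq> 0 \<Longrightarrow> cmod (G z) \<le> K * exp (\<tau> * \<bar>Im z\<bar>) / cmod z"
    and \<sigma>: "\<bar>\<sigma>\<bar> = 1" and "0 \<le> K" "0 < R"
  defines "f \<equiv> \<lambda>z. G z * exp (of_real (\<sigma> * \<tau>) * \<i> * z)"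
  defines "D \<equiv> \<lambda>z. if z = 0 then deriv f 0 else (f z - f 0) / (z - 0)"
  shows "D holomorphic_on UNIV"
    and "cmod (integral {-R..R} (\<lambda>x. D (of_real x)) - of_real (\<sigma> * pi) * \<i> * G 0) \<le> K * pi / R"
proof -
  have holf: "f holomorphic_on UNIV" unfolding f_def by (intro holomorphic_intros hol)
  show holD: "D holomorphic_on UNIV" unfolding D_def by (rule pole_lemma[OF holf]) simp
  define p where "p = part_circlepath 0 R 0 (\<sigma> * pi)"
  define l where "l = linepath (of_real (- R)) (of_real R :: complex)"
  have vp: "valid_path p" "valid_path l" by (simp_all add: p_def l_def)
  have on_p: "cmod z = R \<and> 0 \<le> \<sigma> * Im z" if zp: "z \<in> path_image p" for z
  proof -
    obtain u where u: "0 \<le> u" "u \<le> 1" and z: "z = of_real R * exp (\<i> * of_real (u * (\<sigma> * pi)))"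
      using zp by (auto simp: p_def path_image_def part_circlepath_def linepath_def scaleR_conv_of_real)
    have "z = of_real R * cis (u * (\<sigma> * pi))" by (simp add: z cis_conv_exp)
    hence Im: "Im z = R * sin (u * (\<sigma> * pi))" and nz: "cmod z = R" using \<open>0 < R\<close> by (simp_all add: norm_mult)
    have "0 \<le> sin (u * pi)" using u by (intro sin_ge_zero) (auto simp: mult_left_le_one_le)
    moreover have "\<sigma> = 1 \<or> \<sigma> = - 1" using \<sigma> by linarith
    ultimately show ?thesis using Im nz \<open>0 < R\<close> by auto
  qed
  have p0: "path_image p \<subseteq> - {0}" using on_p \<open>0 < R\<close> by fastforce
  have ends: "pathfinish p = of_real (- R)"
  proof -
    have "\<sigma> = 1 \<or> \<sigma> = - 1" using \<sigma> by linarith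
    thus ?thesis by (auto simp: p_def exp_minus)
  qed
  have "(D has_contour_integral 0) (l +++ p)"
    by (rule Cauchy_theorem_convex_simple[OF holD])
       (use vp ends in \<open>auto simp: p_def l_def intro!: valid_path_join\<close>)
  hence "0 = contour_integral (l +++ p) D" by (simp add: contour_integral_unique)
  also have "\<dots> = contour_integral l D + contour_integral p D"
    using vp by (intro contour_integral_join contour_integrable_holomorphic_simple[OF holD]) auto
  \<comment> \<open>On the arc the subtracted term is harmless and can be integrated explicitly; it
    produces the half residue \<open>\<sigma> * pi * \<i> * G 0\<close>.\<close>
  also have "contour_integral p D = contour_integral p (\<lambda>z. f z / z) - f 0 * contour_integral p (\<lambda>z. 1 / z)"
  proof -
    have i1: "(\<lambda>z. f z / z) contour_integrable_on p"
      by (rule contour_integrable_holomorphic_simple[of _ "- {0}"])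
         (use vp p0 in \<open>auto intro!: holomorphic_intros holomorphic_on_subset[OF holf]\<close>)
    have i2: "(\<lambda>z. 1 / z) contour_integrable_on p"
      by (rule contour_integrable_holomorphic_simple[of _ "- {0}"])
         (use vp p0 in \<open>auto intro!: holomorphic_intros\<close>)
    have "contour_integral p D = contour_integral p (\<lambda>z. f z / z - f 0 * (1 / z))"
      using p0 by (intro contour_integral_eq) (auto simp: D_def diff_divide_distrib)
    also have "\<dots> = contour_integral p (\<lambda>z. f z / z) - contour_integral p (\<lambda>z. f 0 * (1 / z))"
      by (intro contour_integral_diff contour_integrable_lmul i1 i2)
    also have "contour_integral p (\<lambda>z. f 0 * (1 / z)) = f 0 * contour_integral p (\<lambda>z. 1 / z)"
      by (rule contour_integral_lmul[OF i2])
    finally show ?thesis .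
  qed
  finally have "contour_integral l D - of_real (\<sigma> * pi) * \<i> * G 0 = - contour_integral p (\<lambda>z. f z / z)"
    unfolding p_def contour_integral_arc_inverse[OF \<open>0 < R\<close>]
    by (simp add: f_def add_eq_0_iff algebra_simps)
  moreover have "contour_integral l D = integral {-R..R} (\<lambda>x. D (of_real x))"
    unfolding l_def using \<open>0 < R\<close> by (subst contour_integral_linepath_Reals_eq) auto
  moreover have "cmod (contour_integral p (\<lambda>z. f z / z)) \<le> K / R\<^sup>2 * R * \<bar>\<sigma> * pi - 0\<bar>"
    unfolding p_def
  proof (rule contour_integral_bound_part_circlepath)
    show "(\<lambda>z. f z / z) contour_integrable_on part_circlepath 0 R 0 (\<sigma> * pi)"
      by (rule contour_integrable_holomorphic_simple[of _ "- {0}"])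
         (use vp p0 p_def in \<open>auto intro!: holomorphic_intros holomorphic_on_subset[OF holf]\<close>)
    fix z assume "z \<in> path_image (part_circlepath 0 R 0 (\<sigma> * pi))"
    hence z: "cmod z = R" "0 \<le> \<sigma> * Im z" using on_p[of z] by (auto simp: p_def)
    hence "\<bar>Im z\<bar> = \<sigma> * Im z" using \<sigma> by (metis abs_mult abs_of_nonneg mult_1)
    hence "cmod (f z) \<le> K * exp (\<tau> * (\<sigma> * Im z)) / R * exp (- (\<tau> * (\<sigma> * Im z)))"
      using growth[of z] z \<open>0 < R\<close> \<open>0 \<le> K\<close> unfolding f_def norm_mult
      by (intro mult_mono) (auto simp: mult_ac)
    also have "\<dots> = K / R" by (simp add: exp_minus)
    finally show "cmod (f z / z) \<le> K / R\<^sup>2"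
      using \<open>0 < R\<close> z by (simp add: norm_divide power2_eq_square field_simps)
  qed (use \<open>0 \<le> K\<close> \<open>0 < R\<close> in auto)
  ultimately show "cmod (integral {-R..R} (\<lambda>x. D (of_real x)) - of_real (\<sigma> * pi) * \<i> * G 0) \<le> K * pi / R"
    using \<sigma> \<open>0 < R\<close> by (simp add: abs_mult power2_eq_square mult.commute)
qed

text \<open>The sine is a difference of two exponentials, closed in opposite half-planes. Both
  functions \<open>f \<sigma>\<close> take the value \<open>G 0\<close> at 0, so the subtracted
  terms cancel on the line while the two half residues add up to
  \<open>2 * pi * \<i> * G 0\<close>.\<close>

lemma tendsto_sine_kernel_integral:
  fixes \<tau> K :: real and G :: "complex \<Rightarrow> complex" and h :: "real \<Rightarrow> complex"
  assumes hol: "G holomorphic_on UNIV"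
    and growth: "\<And>z. z \<noteq> 0 \<Longrightarrow> cmod (G z) \<le> K * exp (\<tau> * \<bar>Im z\<bar>) / cmod z"
    and h: "\<And>x. x \<noteq> 0 \<Longrightarrow> h x = G (of_real x) * of_real (sin (\<tau> * x) / (pi * x))"
  shows "((\<lambda>R. integral {-R..R} h) \<longlongrightarrow> G 0) at_top"
proof -
  define f where "f = (\<lambda>\<sigma> z. G z * exp (of_real (\<sigma> * \<tau>) * \<i> * z))"
  define D where "D = (\<lambda>\<sigma> z. if z = 0 then deriv (f \<sigma>) 0 else (f \<sigma> z - f \<sigma> 0) / (z - 0))"
  have K: "0 \<le> K" using growth[of 1] order_trans[OF norm_ge_zero[of "G 1"]] by simp
  have semi: "D \<sigma> holomorphic_on UNIV"
    "cmod (integral {-R..R} (\<lambda>x. D \<sigma> (of_real x)) - of_real (\<sigma> * pi) * \<i> * G 0) \<le> K * pi / R"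
    if "\<bar>\<sigma>\<bar> = 1" "0 < R" for \<sigma> R
    using holomorphic_difference_quotient_semicircle[of G K \<tau> \<sigma> R, OF hol _ that(1) K that(2)] growth
    unfolding D_def f_def by blast+
  have est: "cmod (integral {-R..R} h - G 0) \<le> K / R" if "R > 0" for R
  proof -
    let ?I = "\<lambda>\<sigma>. integral {-R..R} (\<lambda>x. D \<sigma> (of_real x))"
    have int: "(\<lambda>x. D \<sigma> (of_real x)) integrable_on {-R..R}" if "\<bar>\<sigma>\<bar> = 1" for \<sigma>
      by (intro integrable_continuous_real holomorphic_on_line semi(1)[OF that \<open>R > 0\<close>])
    have "integral {-R..R} h = integral {-R..R} (\<lambda>x. 1 / (2 * pi * \<i>) * (D 1 (of_real x) - D (- 1) (of_real x)))"
    \<comment> \<open>\<open>h\<close> is prescribed only away from 0, so the two integrands are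
      compared off a null set.\<close>
    proof (rule integral_spike[of "{0}"])
      fix x assume "x \<in> {-R..R} - {0}"
      hence "x \<noteq> 0" by simp
      have "D 1 (of_real x) - D (- 1) (of_real x)
            = G (of_real x) * (exp (\<i> * of_real (\<tau> * x)) - exp (- (\<i> * of_real (\<tau> * x)))) / of_real x"
        using \<open>x \<noteq> 0\<close> by (simp add: D_def f_def diff_divide_distrib right_diff_distrib mult_ac)
      also have "exp (\<i> * of_real (\<tau> * x)) - exp (- (\<i> * of_real (\<tau> * x))) = 2 * \<i> * of_real (sin (\<tau> * x))"
        unfolding sin_of_real[symmetric] sin_exp_eq by simp
      finally show "1 / (2 * pi * \<i>) * (D 1 (of_real x) - D (- 1) (of_real x)) = h x"
        using \<open>x \<noteq> 0\<close> by (simp add: h)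
    qed simp
    also have "\<dots> = 1 / (2 * pi * \<i>) * (?I 1 - ?I (- 1))"
      using int[of 1] int[of "-1"] by (simp add: integral_diff)
    also have "\<dots> - G 0 = 1 / (2 * pi * \<i>) * ((?I 1 - of_real (1 * pi) * \<i> * G 0) - (?I (- 1) - of_real (- 1 * pi) * \<i> * G 0))"
      by (simp add: field_simps)
    finally have "cmod (integral {-R..R} h - G 0) = 1 / (2 * pi) *
        cmod ((?I 1 - of_real (1 * pi) * \<i> * G 0) - (?I (- 1) - of_real (- 1 * pi) * \<i> * G 0))"
      by (simp add: norm_mult norm_divide)
    also have "\<dots> \<le> 1 / (2 * pi) * (K * pi / R + K * pi / R)"
      by (intro mult_left_mono order_trans[OF norm_triangle_ineq4] add_mono semi(2) \<open>R > 0\<close>) auto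
    also have "\<dots> = K / R" by simp
    finally show ?thesis .
  qed
  have "((\<lambda>R. K / R) \<longlongrightarrow> 0) at_top"
    by (intro tendsto_divide_0[OF tendsto_const] filterlim_at_top_imp_at_infinity filterlim_ident)
  moreover have "\<forall>\<^sub>F R in at_top. cmod (integral {-R..R} h - G 0) \<le> K / R"
    using eventually_gt_at_top by (rule eventually_mono) (rule est)
  ultimately have "((\<lambda>R. integral {-R..R} h - G 0) \<longlongrightarrow> 0) at_top"
    by (rule Lim_null_comparison[rotated])
  thus ?thesis by (simp add: LIM_zero_iff)
qed

section \<open>Cosine transforms and the reproducing kernel\<close>

lemma norm_sin_le_exp_Im: "cmod (sin z) \<le> exp \<bar>Im z\<bar>"
proof -
  have "cmod (exp (\<i> * z) - exp (- (\<i> * z))) \<le> cmod (exp (\<i> * z)) + cmod (exp (- (\<i> * z)))"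
    by (rule norm_triangle_ineq4)
  also have "\<dots> \<le> 2 * exp \<bar>Im z\<bar>" by (auto simp: abs_if)
  finally show ?thesis by (simp add: sin_exp_eq norm_divide norm_mult)
qed

text \<open>The kernel \<open>k\<close> of the overview is the transform of
  \<open>1 / P (t\<^sup>2)\<close>, and the sine kernel is the transform of the constant 1.\<close>

definition cos_transform :: "(real \<Rightarrow> real) \<Rightarrow> complex \<Rightarrow> complex" where
  "cos_transform \<phi> z = integral {0..1} (\<lambda>t. cos (of_real (pi * t) * z) * of_real (\<phi> t))"

text \<open>A general \<open>e\<close> serves both differentiations, of the cosine and then of the
  negative sine.\<close>

lemma parametric_integral_has_field_derivative:
  fixes e e' :: "complex \<Rightarrow> complex" and \<phi> :: "real \<Rightarrow> real"
  assumes e: "\<And>w. (e has_field_derivative e' w) (at w)" and e': "continuous_on UNIV e'"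
    and \<phi>: "continuous_on {0..1} \<phi>"
  shows "((\<lambda>z. integral {0..1} (\<lambda>t. e (of_real (pi * t) * z) * of_real (\<phi> t))) has_field_derivative
           integral {0..1} (\<lambda>t. e' (of_real (pi * t) * z) * of_real (pi * t * \<phi> t))) (at z)"
proof -
  have ce: "continuous_on UNIV e" using e by (meson DERIV_isCont continuous_at_imp_continuous_on)
  have "((\<lambda>z. integral (cbox 0 1) (\<lambda>t. e (of_real (pi * t) * z) * of_real (\<phi> t))) has_field_derivative
           integral (cbox 0 1) (\<lambda>t. e' (of_real (pi * t) * z) * of_real (pi * t * \<phi> t))) (at z within UNIV)"
  proof (rule leibniz_rule_field_derivative)
    fix x :: complex and t :: real
    have "((\<lambda>x. e (of_real (pi * t) * x)) has_field_derivative e' (of_real (pi * t) * x) * of_real (pi * t)) (at x)"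
      by (rule DERIV_chain2[OF e]) (auto intro!: derivative_eq_intros)
    from DERIV_cmult_right[OF this, of "of_real (\<phi> t)"]
    show "((\<lambda>x. e (of_real (pi * t) * x) * of_real (\<phi> t)) has_field_derivative
        e' (of_real (pi * t) * x) * of_real (pi * t * \<phi> t)) (at x within UNIV)"
      by (simp add: mult_ac)
  next
    show "(\<lambda>t. e (of_real (pi * t) * x) * of_real (\<phi> t)) integrable_on cbox 0 1" for x
      by (intro integrable_continuous continuous_intros continuous_on_compose2[OF ce]) (use \<phi> in auto)
    show "continuous_on (UNIV \<times> cbox 0 1) (\<lambda>(x, t). e' (of_real (pi * t) * x) * of_real (pi * t * \<phi> t))"
      unfolding split_beta
      by (intro continuous_intros continuous_on_compose2[OF e'] continuous_on_compose2[OF \<phi>]) auto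
  qed auto
  thus ?thesis by simp
qed

lemma cos_transform_has_field_derivative:
  assumes "continuous_on {0..1} \<phi>"
  shows "(cos_transform \<phi> has_field_derivative
           integral {0..1} (\<lambda>t. - sin (of_real (pi * t) * z) * of_real (pi * t * \<phi> t))) (at z)"
  unfolding cos_transform_def[abs_def]
  by (rule parametric_integral_has_field_derivative[where e = cos and e' = "\<lambda>w. - sin w"])
     (auto intro!: derivative_eq_intros continuous_intros assms)

lemma cos_transform_holomorphic:
  assumes "continuous_on {0..1} \<phi>"
  shows "cos_transform \<phi> holomorphic_on UNIV"
  using cos_transform_has_field_derivative[OF assms]
  by (auto simp: holomorphic_on_def field_differentiable_def intro: has_field_derivative_at_within)

lemma deriv_deriv_cos_transform:
  assumes \<phi>: "continuous_on {0..1} \<phi>"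
  shows "deriv (deriv (cos_transform \<phi>)) = (\<lambda>z. - of_real (pi\<^sup>2) * cos_transform (\<lambda>t. t\<^sup>2 * \<phi> t) z)"
proof
  fix z
  have d: "deriv (cos_transform \<phi>) = (\<lambda>z. integral {0..1} (\<lambda>t. - sin (of_real (pi * t) * z) * of_real (pi * t * \<phi> t)))"
    by (intro ext DERIV_imp_deriv cos_transform_has_field_derivative \<phi>)
  have "deriv (deriv (cos_transform \<phi>)) z
        = integral {0..1} (\<lambda>t. - cos (of_real (pi * t) * z) * of_real (pi * t * (pi * t * \<phi> t)))"
    unfolding d
    by (intro DERIV_imp_deriv parametric_integral_has_field_derivative[where e = "\<lambda>w. - sin w" and e' = "\<lambda>w. - cos w"])
       (auto intro!: derivative_eq_intros continuous_intros \<phi>)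
  also have "\<dots> = integral {0..1} (\<lambda>t. - of_real (pi\<^sup>2) * (cos (of_real (pi * t) * z) * of_real (t\<^sup>2 * \<phi> t)))"
    by (simp add: power2_eq_square mult_ac)
  also have "\<dots> = - of_real (pi\<^sup>2) * cos_transform (\<lambda>t. t\<^sup>2 * \<phi> t) z"
    unfolding cos_transform_def by (rule integral_mult_right)
  finally show "deriv (deriv (cos_transform \<phi>)) z = - of_real (pi\<^sup>2) * cos_transform (\<lambda>t. t\<^sup>2 * \<phi> t) z" .
qed

text \<open>Two derivatives return a cosine transform, with weight multiplied by
  \<open>- pi\<^sup>2 * t\<^sup>2\<close>. Even orders suffice, as moving \<open>n\<close>
  derivatives onto the kernel gives it \<open>2 * n\<close> of them.\<close>

lemma even_higher_deriv_cos_transform: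
  assumes \<phi>: "continuous_on {0..1} \<phi>"
  shows "(deriv ^^ (2 * n)) (cos_transform \<phi>) = (\<lambda>z. (-1) ^ n * of_real (pi ^ (2 * n)) * cos_transform (\<lambda>t. t ^ (2 * n) * \<phi> t) z)"
proof (induction n)
  case (Suc n)
  let ?\<phi> = "\<lambda>t. t ^ (2 * n) * \<phi> t"
  have c: "continuous_on {0..1} ?\<phi>" by (intro continuous_intros \<phi>)
  have hol: "cos_transform ?\<phi> holomorphic_on UNIV" by (rule cos_transform_holomorphic[OF c])
  define k :: complex where "k = (-1) ^ n * of_real (pi ^ (2 * n))"
  have "(deriv ^^ (2 * Suc n)) (cos_transform \<phi>) = (deriv ^^ 2) (\<lambda>z. k * cos_transform ?\<phi> z)"
    unfolding k_def Suc.IH[symmetric] by (simp add: numeral_2_eq_2)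
  also have "\<dots> = (\<lambda>z. k * (deriv ^^ 2) (cos_transform ?\<phi>) z)"
    by (intro ext higher_deriv_cmult[OF _ _ open_UNIV] hol) simp
  also have "\<dots> = (\<lambda>z. k * (- of_real (pi\<^sup>2) * cos_transform (\<lambda>t. t\<^sup>2 * ?\<phi> t) z))"
    using deriv_deriv_cos_transform[OF c] by (simp add: numeral_2_eq_2)
  finally show ?case by (simp add: k_def power2_eq_square mult_ac)
qed simp

lemma cos_transform_of_real:
  assumes \<phi>: "continuous_on {0..1} \<phi>"
  shows "cos_transform \<phi> (of_real x) = of_real (integral {0..1} (\<lambda>t. cos (pi * t * x) * \<phi> t))"
proof -
  have "((\<lambda>t. cos (pi * t * x) * \<phi> t) has_integral integral {0..1} (\<lambda>t. cos (pi * t * x) * \<phi> t)) {0..1}"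
    by (intro integrable_integral integrable_continuous_real continuous_intros \<phi>)
  hence "((\<lambda>t. of_real (cos (pi * t * x) * \<phi> t) :: complex) has_integral
            of_real (integral {0..1} (\<lambda>t. cos (pi * t * x) * \<phi> t))) {0..1}"
    by (rule has_integral_of_real)
  thus ?thesis unfolding cos_transform_def
    by (intro integral_unique) (simp flip: cos_of_real)
qed

text \<open>One integration by parts bounds \<open>x\<close> times the transform, the boundary term
  at \<open>t = 0\<close> vanishing with the sine. Everything is kept multiplied by
  \<open>x\<close>, so \<open>x = 0\<close> needs no separate case; adding the trivial bound gives
  the denominator \<open>1 + x\<^sup>2\<close>.\<close>

lemma cos_transform_line_decay:
  fixes \<phi> \<phi>' :: "real \<Rightarrow> real"
  assumes d: "\<And>t. t \<in> {0..1} \<Longrightarrow> (\<phi> has_real_derivative \<phi>' t) (at t within {0..1})"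
    and c: "continuous_on {0..1} \<phi>'"
    and B: "\<And>t. t \<in> {0..1} \<Longrightarrow> \<bar>\<phi> t\<bar> \<le> B" and B': "\<And>t. t \<in> {0..1} \<Longrightarrow> \<bar>\<phi>' t\<bar> \<le> B'"
  shows "(cmod (cos_transform \<phi> (of_real x)))\<^sup>2 \<le> 2 * (B + B')\<^sup>2 * inverse (1 + x\<^sup>2)"
proof -
  define v where "v = integral {0..1} (\<lambda>t. cos (pi * t * x) * \<phi> t)"
  have c\<phi>: "continuous_on {0..1} \<phi>" using d by (rule DERIV_continuous_on)
  have BB: "0 \<le> B" "0 \<le> B'" using B[of 0] B'[of 0] by auto
  have "norm v \<le> B * (1 - 0)" unfolding v_def
  proof (rule integral_bound)
    fix t :: real assume "t \<in> {0..1}"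
    thus "norm (cos (pi * t * x) * \<phi> t) \<le> B"
      using mult_mono[of "\<bar>cos (pi * t * x)\<bar>" 1 "\<bar>\<phi> t\<bar>" B] B[of t] by (simp add: abs_mult)
  qed (auto intro!: continuous_intros c\<phi>)
  hence v1: "\<bar>v\<bar> \<le> B + B'" using BB by simp
  have v2: "\<bar>x\<bar> * \<bar>v\<bar> \<le> B + B'"
  proof -
    define w where "w = integral {0..1} (\<lambda>t. sin (pi * t * x) * \<phi>' t)"
    have iv: "((\<lambda>t. cos (pi * t * x) * \<phi> t) has_integral v) {0..1}"
      unfolding v_def by (intro integrable_integral integrable_continuous_real continuous_intros c\<phi>)
    have iw: "((\<lambda>t. sin (pi * t * x) * \<phi>' t) has_integral w) {0..1}"
      unfolding w_def by (intro integrable_integral integrable_continuous_real continuous_intros c)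
    have i1: "((\<lambda>t. pi * x * (cos (pi * t * x) * \<phi> t) + sin (pi * t * x) * \<phi>' t) has_integral pi * x * v + w) {0..1}"
      by (intro has_integral_add has_integral_mult_right iv iw)
    have i2: "((\<lambda>t. pi * x * (cos (pi * t * x) * \<phi> t) + sin (pi * t * x) * \<phi>' t)
        has_integral sin (pi * 1 * x) * \<phi> 1 - sin (pi * 0 * x) * \<phi> 0) {0..1}"
      by (rule fundamental_theorem_of_calculus)
         (auto intro!: derivative_eq_intros d simp: mult_ac simp flip: has_real_derivative_iff_has_vector_derivative)
    have "pi * x * v + w = sin (pi * x) * \<phi> 1"
      using has_integral_unique[OF i1 i2] by simp
    hence "pi * (x * v) = sin (pi * x) * \<phi> 1 - w" by (simp add: algebra_simps)
    hence "pi * (\<bar>x\<bar> * \<bar>v\<bar>) = \<bar>sin (pi * x) * \<phi> 1 - w\<bar>" by (metis abs_mult abs_of_pos pi_gt_zero)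
    also have "\<dots> \<le> \<bar>sin (pi * x) * \<phi> 1\<bar> + \<bar>w\<bar>" by (rule abs_triangle_ineq4)
    also have "\<bar>sin (pi * x) * \<phi> 1\<bar> \<le> B"
      using mult_mono[of "\<bar>sin (pi * x)\<bar>" 1 "\<bar>\<phi> 1\<bar>" B] B[of 1] by (simp add: abs_mult)
    also have "\<bar>w\<bar> \<le> B'"
    proof -
      have "norm w \<le> B' * (1 - 0)" unfolding w_def
      proof (rule integral_bound)
        fix t :: real assume "t \<in> {0..1}"
        thus "norm (sin (pi * t * x) * \<phi>' t) \<le> B'"
          using mult_mono[of "\<bar>sin (pi * t * x)\<bar>" 1 "\<bar>\<phi>' t\<bar>" B'] B'[of t] by (simp add: abs_mult)
      qed (auto intro!: continuous_intros c)
      thus ?thesis by simp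
    qed
    finally have "pi * (\<bar>x\<bar> * \<bar>v\<bar>) \<le> B + B'" by simp
    moreover have "1 * (\<bar>x\<bar> * \<bar>v\<bar>) \<le> pi * (\<bar>x\<bar> * \<bar>v\<bar>)"
      using pi_ge_two by (intro mult_right_mono) auto
    ultimately show ?thesis by simp
  qed
  have "v\<^sup>2 \<le> (B + B')\<^sup>2" using power_mono[OF v1, of 2] by simp
  moreover have "x\<^sup>2 * v\<^sup>2 \<le> (B + B')\<^sup>2"
    using power_mono[OF v2, of 2] by (simp add: power_mult_distrib)
  ultimately have "v\<^sup>2 * (1 + x\<^sup>2) \<le> 2 * (B + B')\<^sup>2" by (simp add: algebra_simps)
  moreover have "0 < 1 + x\<^sup>2" by (rule add_pos_nonneg) auto
  ultimately have "v\<^sup>2 \<le> 2 * (B + B')\<^sup>2 * inverse (1 + x\<^sup>2)" by (simp add: field_simps)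
  moreover have "cmod (cos_transform \<phi> (of_real x)) = \<bar>v\<bar>"
    unfolding cos_transform_of_real[OF c\<phi>] v_def by simp
  ultimately show ?thesis by simp
qed

text \<open>The type comes from the bound of the cosine by \<open>exp (pi * |z|)\<close>; square
  integrability comes from the decay on the line, which uses the continuous derivative of
  \<phi>.\<close>

lemma cos_transform_PW2:
  fixes \<phi> \<phi>' :: "real \<Rightarrow> real"
  assumes d: "\<And>t. t \<in> {0..1} \<Longrightarrow> (\<phi> has_real_derivative \<phi>' t) (at t within {0..1})"
    and c: "continuous_on {0..1} \<phi>'"
  shows "cos_transform \<phi> \<in> PW2"
proof -
  have c\<phi>: "continuous_on {0..1} \<phi>" using d by (rule DERIV_continuous_on)
  have "bounded (\<phi> ` {0..1})" "bounded (\<phi>' ` {0..1})"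
    by (intro compact_imp_bounded compact_continuous_image c c\<phi> compact_Icc)+
  then obtain B B' where "\<forall>y\<in>\<phi> ` {0..1}. norm y \<le> B" and "\<forall>y\<in>\<phi>' ` {0..1}. norm y \<le> B'"
    unfolding bounded_iff by blast
  hence B: "\<And>t. t \<in> {0..1} \<Longrightarrow> \<bar>\<phi> t\<bar> \<le> B" and B': "\<And>t. t \<in> {0..1} \<Longrightarrow> \<bar>\<phi>' t\<bar> \<le> B'" by simp_all
  have B0: "0 \<le> B" using B[of 0] by auto
  have bound: "cmod (cos_transform \<phi> z) \<le> B * exp (pi * cmod z)" for z
  proof -
    have "cmod (cos_transform \<phi> z) \<le> (exp (pi * cmod z) * B) * (1 - 0)"
      unfolding cos_transform_def
    proof (rule integral_bound)
      fix t :: real assume t: "t \<in> {0..1}"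
      have "cmod (of_real (pi * t) * z) \<le> pi * cmod z"
        using t by (simp add: norm_mult mult_left_le_one_le)
      hence "cmod (cos (of_real (pi * t) * z)) \<le> exp (pi * cmod z)"
        using norm_cos_le[of "of_real (pi * t) * z"] by (meson exp_le_cancel_iff order_trans)
      thus "cmod (cos (of_real (pi * t) * z) * of_real (\<phi> t)) \<le> exp (pi * cmod z) * B"
        unfolding norm_mult using B[OF t] by (intro mult_mono) auto
    qed (auto intro!: continuous_intros c\<phi>)
    thus ?thesis by (simp add: mult.commute)
  qed
  have "\<exists>C>0. \<forall>z. cmod (cos_transform \<phi> z) \<le> C * exp ((pi + \<epsilon>) * cmod z)" if "\<epsilon> > 0" for \<epsilon>
  proof (intro exI[of _ "B + 1"] conjI allI)
    fix z
    have "B * exp (pi * cmod z) \<le> (B + 1) * exp ((pi + \<epsilon>) * cmod z)"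
      using B0 that by (intro mult_mono) (auto intro: mult_right_mono)
    thus "cmod (cos_transform \<phi> z) \<le> (B + 1) * exp ((pi + \<epsilon>) * cmod z)" using bound[of z] by linarith
  qed (use B0 in auto)
  moreover have "integrable lborel (\<lambda>x. (cmod (cos_transform \<phi> (of_real x)))\<^sup>2)"
  proof (rule Bochner_Integration.integrable_bound)
    show "integrable lborel (\<lambda>x::real. 2 * (B + B')\<^sup>2 * inverse (1 + x\<^sup>2))"
      by (intro integrable_mult_right integrable_inverse_1_plus_square_real)
    show "AE x in lborel. norm ((cmod (cos_transform \<phi> (of_real x)))\<^sup>2) \<le> norm (2 * (B + B')\<^sup>2 * inverse (1 + x\<^sup>2))"
      using cos_transform_line_decay[OF d c B B'] by (auto intro: order_trans[OF _ abs_ge_self])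
  qed (use holomorphic_on_line(2)[OF cos_transform_holomorphic[OF c\<phi>]] in measurable)
  ultimately show ?thesis
    using cos_transform_holomorphic[OF c\<phi>] by (auto simp: PW2_def exponential_type_le_def)
qed

section \<open>The sine kernel and its reproducing property\<close>

lemma cos_transform_1:
  assumes "z \<noteq> 0"
  shows "cos_transform (\<lambda>_. 1) z = sin (of_real pi * z) / (of_real pi * z)"
proof -
  define F where "F = (\<lambda>w. sin (of_real pi * w * z) / (of_real pi * z))"
  have "((\<lambda>t. cos (of_real pi * of_real t * z)) has_integral F (of_real 1) - F (of_real 0)) {0..1}"
  proof (rule fundamental_theorem_of_calculus)
    fix t :: real
    have "(F has_field_derivative cos (of_real pi * of_real t * z)) (at (of_real t))"
      unfolding F_def using assms by (auto intro!: derivative_eq_intros)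
    thus "((\<lambda>t. F (of_real t)) has_vector_derivative cos (of_real pi * of_real t * z)) (at t within {0..1})"
      by (rule has_vector_derivative_at_within[OF has_vector_derivative_real_field])
  qed simp
  thus ?thesis unfolding cos_transform_def by (simp add: integral_unique F_def)
qed

lemma norm_cos_transform_1_le:
  assumes "z \<noteq> 0"
  shows "cmod (cos_transform (\<lambda>_. 1) z) \<le> exp (pi * \<bar>Im z\<bar>) / cmod z"
proof -
  have "cmod (cos_transform (\<lambda>_. 1) z) = cmod (sin (of_real pi * z)) / (pi * cmod z)"
    by (simp add: cos_transform_1[OF assms] norm_divide norm_mult)
  also have "\<dots> \<le> exp (pi * \<bar>Im z\<bar>) / (1 * cmod z)"
    using norm_sin_le_exp_Im[of "of_real pi * z"] assms pi_ge_two
    by (intro frac_le mult_right_mono) (auto simp: abs_mult)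
  finally show ?thesis by simp
qed

lemma cos_transform_1_line:
  fixes x :: real
  shows "(cmod (cos_transform (\<lambda>_. 1) (of_real x)))\<^sup>2 \<le> 2 * inverse (1 + x\<^sup>2)"
    and "cmod (cos_transform (\<lambda>_. 1) (of_real x)) \<le> 1"
proof -
  show "(cmod (cos_transform (\<lambda>_. 1) (of_real x)))\<^sup>2 \<le> 2 * inverse (1 + x\<^sup>2)"
    using cos_transform_line_decay[of "\<lambda>_. 1" "\<lambda>_. 0" 1 0 x] by simp
  have "cmod (cos_transform (\<lambda>_. 1) (of_real x)) \<le> 1 * (1 - 0)"
    unfolding cos_transform_def
  proof (rule integral_bound)
    fix t :: real
    show "cmod (cos (of_real (pi * t) * of_real x) * of_real 1) \<le> 1"
      unfolding of_real_mult[symmetric] cos_of_real by simp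
  qed (auto intro!: continuous_intros)
  thus "cmod (cos_transform (\<lambda>_. 1) (of_real x)) \<le> 1" by simp
qed

text \<open>The factor \<open>s (\<delta> * z)\<close> supplies the decay that the contour argument
  requires, and the product has type \<open>pi * (1 + \<delta>)\<close>. Dilating the kernel by
  \<open>1 + \<delta>\<close> matches that type; its prefactor restores the denominator
  \<open>pi * x\<close>. The dominating function is independent of \<delta>, ready for the
  limit.\<close>

lemma PW2_integral_sine_kernel_product:
  assumes g: "g \<in> PW2" and \<delta>: "0 < \<delta>" "\<delta> < 1"
  defines "s \<equiv> cos_transform (\<lambda>_. 1)"
  defines "h \<equiv> \<lambda>x::real. g (of_real x) * s (of_real (\<delta> * x)) * (of_real (1 + \<delta>) * s (of_real ((1 + \<delta>) * x)))"
  shows "cmod (h x) \<le> (cmod (g (of_real x)))\<^sup>2 + 2 * inverse (1 + x\<^sup>2)"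
    and "integrable lborel h" and "(LINT x|lborel. h x) = g 0"
proof -
  have s: "s holomorphic_on UNIV" unfolding s_def by (intro cos_transform_holomorphic) simp
  have cs: "continuous_on UNIV s" by (rule holomorphic_on_imp_continuous_on[OF s])
  note hg = PW2_D(2)[OF g]
  have ch: "continuous_on UNIV h" unfolding h_def
    by (intro continuous_intros holomorphic_on_line(1)[OF hg] continuous_on_compose2[OF cs]) auto
  have s0: "s 0 = 1" by (simp add: s_def cos_transform_def)
  show bound: "cmod (h x) \<le> (cmod (g (of_real x)))\<^sup>2 + 2 * inverse (1 + x\<^sup>2)" for x
  proof -
    define p q where "p = cmod (g (of_real x))" and "q = cmod (s (of_real ((1 + \<delta>) * x)))"
    have "cmod (h x) = p * cmod (s (of_real (\<delta> * x))) * ((1 + \<delta>) * q)"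
      using \<delta> by (simp add: h_def p_def q_def norm_mult del: of_real_add of_real_mult)
    also have "\<dots> \<le> p * 1 * (2 * q)"
      unfolding s_def using cos_transform_1_line(2) \<delta>
      by (intro mult_mono) (auto simp: p_def q_def simp del: of_real_mult)
    also have "\<dots> \<le> p\<^sup>2 + q\<^sup>2" using sum_squares_bound[of p q] by simp
    also have "q\<^sup>2 \<le> 2 * inverse (1 + ((1 + \<delta>) * x)\<^sup>2)"
      unfolding q_def s_def by (rule cos_transform_1_line)
    also have "\<dots> \<le> 2 * inverse (1 + x\<^sup>2)"
    proof -
      have "1 * x\<^sup>2 \<le> (1 + \<delta>)\<^sup>2 * x\<^sup>2" using \<delta> by (intro mult_right_mono) auto
      hence "1 + x\<^sup>2 \<le> 1 + ((1 + \<delta>) * x)\<^sup>2" by (simp add: power_mult_distrib)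
      moreover have "0 < 1 + x\<^sup>2" by (rule add_pos_nonneg) auto
      ultimately show ?thesis by (intro mult_left_mono le_imp_inverse_le) auto
    qed
    finally show ?thesis by (simp add: p_def)
  qed
  show int: "integrable lborel h"
  proof (rule Bochner_Integration.integrable_bound)
    show "integrable lborel (\<lambda>x. (cmod (g (of_real x)))\<^sup>2 + 2 * inverse (1 + x\<^sup>2))"
      using PW2_D(3)[OF g] integrable_inverse_1_plus_square_real by simp
    show "AE x in lborel. norm (h x) \<le> norm ((cmod (g (of_real x)))\<^sup>2 + 2 * inverse (1 + x\<^sup>2))"
      using bound by (auto intro: order_trans[OF _ abs_ge_self])
  qed (use ch in \<open>simp add: borel_measurable_continuous_onI\<close>)
  define G where "G = (\<lambda>z. g z * s (of_real \<delta> * z))"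
  obtain M where M: "0 \<le> M" "\<And>z. cmod (g z) \<le> M * exp (pi * \<bar>Im z\<bar>)"
    using PW2_strip_bound[OF g] by blast
  have "((\<lambda>R. integral {-R..R} h) \<longlongrightarrow> G 0) at_top"
  proof (rule tendsto_sine_kernel_integral)
    have "(\<lambda>z. s (of_real \<delta> * z)) holomorphic_on UNIV"
      by (rule holomorphic_on_compose_gen[of _ _ s UNIV, unfolded o_def]) (auto intro!: holomorphic_intros s)
    thus "G holomorphic_on UNIV" unfolding G_def by (intro holomorphic_intros hg)
    show "cmod (G z) \<le> M / \<delta> * exp ((pi * (1 + \<delta>)) * \<bar>Im z\<bar>) / cmod z" if "z \<noteq> 0" for z
    proof -
      have "cmod (s (of_real \<delta> * z)) \<le> exp (pi * \<bar>Im (of_real \<delta> * z)\<bar>) / cmod (of_real \<delta> * z)"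
        unfolding s_def by (rule norm_cos_transform_1_le) (use that \<delta> in auto)
      also have "\<dots> = exp (pi * (\<delta> * \<bar>Im z\<bar>)) / (\<delta> * cmod z)" using \<delta> by (simp add: norm_mult abs_mult)
      finally have "cmod (G z) \<le> (M * exp (pi * \<bar>Im z\<bar>)) * (exp (pi * (\<delta> * \<bar>Im z\<bar>)) / (\<delta> * cmod z))"
        unfolding G_def norm_mult using M by (intro mult_mono) auto
      also have "\<dots> = M / \<delta> * exp ((pi * (1 + \<delta>)) * \<bar>Im z\<bar>) / cmod z"
        by (simp add: distrib_left distrib_right exp_add mult_ac)
      finally show ?thesis .
    qed
    fix x :: real assume "x \<noteq> 0"
    have nz: "complex_of_real ((1 + \<delta>) * x) \<noteq> 0"
      unfolding of_real_eq_0_iff using \<open>x \<noteq> 0\<close> \<delta> by simp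
    have "s (of_real ((1 + \<delta>) * x)) = of_real (sin (pi * (1 + \<delta>) * x) / (pi * ((1 + \<delta>) * x)))"
      unfolding s_def cos_transform_1[OF nz] by (simp add: mult.assoc flip: sin_of_real)
    hence "of_real (1 + \<delta>) * s (of_real ((1 + \<delta>) * x)) = of_real ((1 + \<delta>) * (sin (pi * (1 + \<delta>) * x) / (pi * ((1 + \<delta>) * x))))"
      by (simp only: of_real_mult)
    also have "(1 + \<delta>) * (sin (pi * (1 + \<delta>) * x) / (pi * ((1 + \<delta>) * x))) = sin (pi * (1 + \<delta>) * x) / (pi * x)"
    proof -
      have "d * (r / (pi * (d * x))) = r / (pi * x)" if "d \<noteq> 0" for d r
        using that by simp
      thus ?thesis using \<delta> by simp
    qed
    finally show "h x = G (of_real x) * of_real (sin (pi * (1 + \<delta>) * x) / (pi * x))"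
      by (simp add: h_def G_def)
  qed
  moreover have "((\<lambda>R. integral {-R..R} h) \<longlongrightarrow> (LINT x|lborel. h x)) at_top"
    by (rule tendsto_integral_truncation[OF ch int])
  ultimately have "(LINT x|lborel. h x) = G 0" using tendsto_unique[OF trivial_limit_at_top_linorder] by blast
  thus "(LINT x|lborel. h x) = g 0" by (simp add: G_def s0)
qed

lemma PW2_reproducing:
  assumes g: "g \<in> PW2"
  shows "(LINT x|lborel. g (of_real x) * cos_transform (\<lambda>_. 1) (of_real x)) = g 0"
proof -
  define s where "s = cos_transform (\<lambda>_. 1)"
  have s: "s holomorphic_on UNIV" unfolding s_def by (intro cos_transform_holomorphic) simp
  have cs: "continuous_on UNIV s" by (rule holomorphic_on_imp_continuous_on[OF s])
  have s0: "s 0 = 1" by (simp add: s_def cos_transform_def)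
  \<comment> \<open>\<open>Suc (Suc n)\<close> keeps every \<open>\<delta> n\<close> strictly below
    1.\<close>
  define \<delta> where "\<delta> = (\<lambda>n::nat. inverse (real (Suc (Suc n))))"
  have \<delta>: "0 < \<delta> n" "\<delta> n < 1" for n by (auto simp: \<delta>_def inverse_less_1_iff)
  have lim\<delta>: "\<delta> \<longlonglongrightarrow> 0" unfolding \<delta>_def by (intro LIMSEQ_Suc LIMSEQ_inverse_real_of_nat)
  define h where "h = (\<lambda>n. \<lambda>x::real. g (of_real x) * s (of_real (\<delta> n * x)) * (of_real (1 + \<delta> n) * s (of_real ((1 + \<delta> n) * x))))"
  have ker: "cmod (h n x) \<le> (cmod (g (of_real x)))\<^sup>2 + 2 * inverse (1 + x\<^sup>2)" "integrable lborel (h n)"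
    "(LINT x|lborel. h n x) = g 0" for n x
    unfolding h_def s_def by (rule PW2_integral_sine_kernel_product[OF g \<delta>])+
  have "(\<lambda>n. LINT x|lborel. h n x) \<longlonglongrightarrow> (LINT x|lborel. g (of_real x) * s (of_real x))"
  proof (rule integral_dominated_convergence)
    show "integrable lborel (\<lambda>x. (cmod (g (of_real x)))\<^sup>2 + 2 * inverse (1 + x\<^sup>2))"
      using PW2_D(3)[OF g] integrable_inverse_1_plus_square_real by simp
    show "AE x in lborel. norm (h n x) \<le> (cmod (g (of_real x)))\<^sup>2 + 2 * inverse (1 + x\<^sup>2)" for n
      using ker(1) by simp
    show "h n \<in> borel_measurable lborel" for n using ker(2)[of n] by (rule borel_measurable_integrable)
    show "(\<lambda>x. g (of_real x) * s (of_real x)) \<in> borel_measurable lborel"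
      using holomorphic_on_line(2)[OF PW2_D(2)[OF g]] holomorphic_on_line(2)[OF s] by measurable
    have "(\<lambda>n. h n x) \<longlonglongrightarrow> g (of_real x) * s (of_real (0 * x)) * (of_real (1 + 0) * s (of_real ((1 + 0) * x)))" for x
      unfolding h_def by (intro tendsto_intros lim\<delta> continuous_on_tendsto_compose[OF cs]) auto
    thus "AE x in lborel. (\<lambda>n. h n x) \<longlonglongrightarrow> g (of_real x) * s (of_real x)"
      by (simp add: s0)
  qed
  moreover note ker(3)
  ultimately show ?thesis by (simp add: s_def LIMSEQ_const_iff)
qed

section \<open>The weighted kernel\<close>

lemma line_energy_add_cmult:
  assumes f: "f \<in> PW2" and g: "g \<in> PW2"
  shows "line_energy (\<lambda>z. f z + of_real c * g z)
         = line_energy f + 2 * c * Re (LINT x|lborel. f (of_real x) * cnj (g (of_real x))) + c\<^sup>2 * line_energy g"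
proof -
  note int = PW2_D(3)[OF f] PW2_D(3)[OF g] PW2_integrable_mult(2)[OF f g]
  have lin: "(LINT x|lborel. A x + 2 * c * B x + c\<^sup>2 * C x) = (LINT x|lborel. A x) + 2 * c * (LINT x|lborel. B x) + c\<^sup>2 * (LINT x|lborel. C x)"
    if "integrable lborel A" "integrable lborel B" "integrable lborel C" for A B C :: "real \<Rightarrow> real"
    using that by simp
  have "(cmod (u + of_real c * v))\<^sup>2 = (cmod u)\<^sup>2 + 2 * c * Re (u * cnj v) + c\<^sup>2 * (cmod v)\<^sup>2" for u v
    by (simp add: cmod_power2) (simp add: power2_eq_square algebra_simps)
  hence "line_energy (\<lambda>z. f z + of_real c * g z) = (LINT x|lborel. (cmod (f (of_real x)))\<^sup>2
           + 2 * c * Re (f (of_real x) * cnj (g (of_real x))) + c\<^sup>2 * (cmod (g (of_real x)))\<^sup>2)"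
    by (simp add: line_energy_def)
  thus ?thesis
    unfolding lin[OF int(1) integrable_Re[OF int(3)] int(2)] integral_Re[OF int(3)] line_energy_def .
qed

text \<open>Zero energy makes the reproducing integral vanish, hence the value at 0. All derivatives
  inherit zero energy, so the Taylor series at 0 is zero.\<close>

lemma line_energy_eq_0_imp:
  assumes f: "f \<in> PW2" and "line_energy f = 0"
  shows "f z = 0"
proof -
  have zero: "g 0 = 0" if g: "g \<in> PW2" and e: "line_energy g = 0" for g
  proof -
    have "AE x in lborel. (cmod (g (of_real x)))\<^sup>2 = 0"
      using e integral_nonneg_eq_0_iff_AE[OF PW2_D(3)[OF g]] by (simp add: line_energy_def)
    hence "AE x in lborel. g (of_real x) * cos_transform (\<lambda>_. 1) (of_real x) = 0"
      by (rule eventually_mono) simp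
    hence "(LINT x|lborel. g (of_real x) * cos_transform (\<lambda>_. 1) (of_real x)) = 0"
      by (rule integral_eq_zero_AE)
    thus ?thesis using PW2_reproducing[OF g] by simp
  qed
  have "(deriv ^^ n) f 0 = 0" for n
  proof (rule zero[OF PW2_higher_deriv[OF f]])
    show "line_energy ((deriv ^^ n) f) = 0"
      using line_energy_higher_deriv_bound(2)[OF f, of 1 n] line_energy_nonneg[of "(deriv ^^ n) f"]
      by (simp add: \<open>line_energy f = 0\<close>)
  qed
  thus ?thesis
    by (intro holomorphic_fun_eq_0_on_connected[OF PW2_D(2)[OF f] open_UNIV connected_UNIV]) auto
qed

section \<open>Reality on the line and the energy form\<close>

lemma deriv_real_on_line:
  assumes hol: "f holomorphic_on UNIV" and real: "\<And>x. cnj (f (of_real x)) = f (of_real x)"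
  shows "cnj (deriv f (of_real x)) = deriv f (of_real x)"
proof -
  have "((\<lambda>x. cnj (f (of_real x))) has_vector_derivative cnj (deriv f (of_real x))) (at x)"
    by (intro has_vector_derivative_cnj holomorphic_on_line(3) hol)
  hence "((\<lambda>x. f (of_real x)) has_vector_derivative cnj (deriv f (of_real x))) (at x)"
    by (simp only: real)
  thus ?thesis using holomorphic_on_line(3)[OF hol] by (rule vector_derivative_unique_at)
qed

text \<open>This removes the conjugate on the kernel in the sesquilinear pairing, so that the
  bilinear integration by parts applies.\<close>

lemma higher_deriv_real_on_line:
  assumes hol: "f holomorphic_on UNIV" and real: "\<And>x. cnj (f (of_real x)) = f (of_real x)"
  shows "cnj ((deriv ^^ n) f (of_real x)) = (deriv ^^ n) f (of_real x)"
proof (induction n arbitrary: x)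
  case (Suc n)
  show ?case using deriv_real_on_line[of "(deriv ^^ n) f"] Suc holomorphic_higher_deriv[OF hol] by simp
qed (simp add: real)

text \<open>A finite sum of energies rather than the integral of a sum, so that quadratic expansions
  are done term by term.\<close>

definition energy_form :: "(nat \<Rightarrow> real) \<Rightarrow> nat \<Rightarrow> (complex \<Rightarrow> complex) \<Rightarrow> real" where
  "energy_form a N g = (\<Sum>n=0..N. a n / pi ^ (2 * n) * line_energy ((deriv ^^ n) g))"

lemma integral_energy_density:
  assumes g: "g \<in> PW2"
  shows "(LINT x|lborel. (\<Sum>n=0..N. a n / pi ^ (2 * n) * (cmod ((deriv ^^ n) g (complex_of_real x)))\<^sup>2))
         = energy_form a N g"
  unfolding energy_form_def line_energy_def
  by (subst Bochner_Integration.integral_sum) (auto intro!: integrable_mult_right PW2_D(3) PW2_higher_deriv g)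

text \<open>Moving all derivatives onto the kernel turns its weight into \<open>P (t\<^sup>2) / P (t\<^sup>2) = 1\<close>, so the
  weighted kernel reproduces the value at \<open>0\<close> with respect to the energy form.\<close>
lemma energy_form_reproducing:
  fixes a :: "nat \<Rightarrow> real" and \<phi> :: "real \<Rightarrow> real"
  assumes \<phi>: "continuous_on {0..1} \<phi>" and k: "cos_transform \<phi> \<in> PW2"
    and inv: "\<And>t. t \<in> {0..1} \<Longrightarrow> (\<Sum>n=0..N. a n * t ^ (2 * n)) * \<phi> t = 1"
    and h: "h \<in> PW2"
  shows "(\<Sum>n=0..N. of_real (a n / pi ^ (2 * n)) *
            (LINT x|lborel. (deriv ^^ n) h (of_real x) * cnj ((deriv ^^ n) (cos_transform \<phi>) (of_real x)))) = h 0"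
proof -
  let ?k = "cos_transform \<phi>"
  have real: "cnj ((deriv ^^ n) ?k (of_real x)) = (deriv ^^ n) ?k (of_real x)" for n x
    by (intro higher_deriv_real_on_line cos_transform_holomorphic \<phi>) (simp add: cos_transform_of_real[OF \<phi>])
  have int: "integrable lborel (\<lambda>x. h (of_real x) * (deriv ^^ (2 * n)) ?k (of_real x))" for n
    by (intro PW2_integrable_mult h PW2_higher_deriv k)
  \<comment> \<open>The sign from \<open>n\<close> integrations by parts cancels the sign from
    differentiating the cosine \<open>2 * n\<close> times.\<close>
  have sum: "(\<Sum>n=0..N. of_real (a n / pi ^ (2 * n)) * ((-1) ^ n * (deriv ^^ (2 * n)) ?k z)) = cos_transform (\<lambda>_. 1) z" for z
  proof -
    have "(\<Sum>n=0..N. of_real (a n / pi ^ (2 * n)) * ((-1) ^ n * (deriv ^^ (2 * n)) ?k z))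
          = (\<Sum>n=0..N. of_real (a n) * cos_transform (\<lambda>t. t ^ (2 * n) * \<phi> t) z)"
      unfolding even_higher_deriv_cos_transform[OF \<phi>]
      by (intro sum.cong refl) (simp flip: power_mult_distrib mult.assoc)
    also have "\<dots> = (\<Sum>n=0..N. integral {0..1} (\<lambda>t. of_real (a n) * (cos (of_real (pi * t) * z) * of_real (t ^ (2 * n) * \<phi> t))))"
      unfolding cos_transform_def by simp
    also have "\<dots> = integral {0..1} (\<lambda>t. \<Sum>n=0..N. of_real (a n) * (cos (of_real (pi * t) * z) * of_real (t ^ (2 * n) * \<phi> t)))"
      by (intro integral_sum[symmetric] integrable_continuous_real continuous_intros \<phi>) auto
    also have "\<dots> = integral {0..1} (\<lambda>t. cos (of_real (pi * t) * z) * of_real 1)"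
    proof (rule Henstock_Kurzweil_Integration.integral_cong)
      fix t :: real assume "t \<in> {0..1}"
      have "(\<Sum>n=0..N. of_real (a n) * (cos (of_real (pi * t) * z) * of_real (t ^ (2 * n) * \<phi> t)))
            = cos (of_real (pi * t) * z) * of_real ((\<Sum>n=0..N. a n * t ^ (2 * n)) * \<phi> t)"
        by (simp add: sum_distrib_left sum_distrib_right mult_ac)
      thus "(\<Sum>n=0..N. of_real (a n) * (cos (of_real (pi * t) * z) * of_real (t ^ (2 * n) * \<phi> t)))
            = cos (of_real (pi * t) * z) * of_real 1"
        by (simp only: inv[OF \<open>t \<in> {0..1}\<close>])
    qed
    finally show ?thesis by (simp only: cos_transform_def)
  qed
  have "(\<Sum>n=0..N. of_real (a n / pi ^ (2 * n)) *
            (LINT x|lborel. (deriv ^^ n) h (of_real x) * cnj ((deriv ^^ n) ?k (of_real x))))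
        = (\<Sum>n=0..N. (LINT x|lborel. of_real (a n / pi ^ (2 * n)) * (-1) ^ n * (h (of_real x) * (deriv ^^ (2 * n)) ?k (of_real x))))"
    unfolding real PW2_integral_by_parts_higher[OF h k] by (simp add: mult.assoc flip: mult_2)
  also have "\<dots> = (LINT x|lborel. (\<Sum>n=0..N. of_real (a n / pi ^ (2 * n)) * (-1) ^ n * (h (of_real x) * (deriv ^^ (2 * n)) ?k (of_real x))))"
    by (intro Bochner_Integration.integral_sum[symmetric] integrable_mult_right int)
  also have "\<dots> = (LINT x|lborel. h (of_real x) * cos_transform (\<lambda>_. 1) (of_real x))"
    unfolding sum[symmetric] sum_distrib_left by (simp add: mult_ac)
  also have "\<dots> = h 0" by (rule PW2_reproducing[OF h])
  finally show ?thesis .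
qed

text \<open>The reproducing identity evaluates both the cross term, applied to \<open>h\<close>, and
  the energy of the kernel, applied to the kernel itself.\<close>

lemma energy_form_add_kernel:
  fixes a :: "nat \<Rightarrow> real" and \<phi> :: "real \<Rightarrow> real"
  assumes \<phi>: "continuous_on {0..1} \<phi>" and k: "cos_transform \<phi> \<in> PW2"
    and inv: "\<And>t. t \<in> {0..1} \<Longrightarrow> (\<Sum>n=0..N. a n * t ^ (2 * n)) * \<phi> t = 1"
    and h: "h \<in> PW2"
  shows "energy_form a N (\<lambda>z. h z + of_real c * cos_transform \<phi> z)
         = energy_form a N h + 2 * c * Re (h 0) + c\<^sup>2 * Re (cos_transform \<phi> 0)"
proof -
  let ?k = "cos_transform \<phi>"
  define B where "B = (\<lambda>f n. Re (LINT x|lborel. (deriv ^^ n) f (of_real x) * cnj ((deriv ^^ n) ?k (of_real x))))"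
  have B: "(\<Sum>n=0..N. a n / pi ^ (2 * n) * B f n) = Re (f 0)" if f: "f \<in> PW2" for f
  proof -
    have "(\<Sum>n=0..N. of_real (a n / pi ^ (2 * n)) *
            (LINT x|lborel. (deriv ^^ n) f (of_real x) * cnj ((deriv ^^ n) ?k (of_real x)))) = f 0"
      by (rule energy_form_reproducing[OF \<phi> k inv f])
    from arg_cong[OF this, of Re] show ?thesis
      by (simp add: B_def del: of_real_divide of_real_power)
  qed
  have kk: "B ?k n = line_energy ((deriv ^^ n) ?k)" for n
    by (simp add: B_def integral_mult_cnj_self)
  have "(deriv ^^ n) (\<lambda>z. h z + of_real c * ?k z) = (\<lambda>z. (deriv ^^ n) h z + of_real c * (deriv ^^ n) ?k z)" for n
  proof
    fix z
    have "(\<lambda>z. of_real c * ?k z) holomorphic_on UNIV" by (intro holomorphic_intros PW2_D(2) k)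
    thus "(deriv ^^ n) (\<lambda>z. h z + of_real c * ?k z) z = (deriv ^^ n) h z + of_real c * (deriv ^^ n) ?k z"
      using higher_deriv_add[OF PW2_D(2)[OF h], of _ z n] higher_deriv_cmult[OF PW2_D(2)[OF k], of z n "of_real c"] by simp
  qed
  hence "energy_form a N (\<lambda>z. h z + of_real c * ?k z)
        = (\<Sum>n=0..N. a n / pi ^ (2 * n) * (line_energy ((deriv ^^ n) h) + 2 * c * B h n + c\<^sup>2 * B ?k n))"
    unfolding kk by (simp add: energy_form_def B_def line_energy_add_cmult PW2_higher_deriv h k)
  also have "\<dots> = energy_form a N h + 2 * c * (\<Sum>n=0..N. a n / pi ^ (2 * n) * B h n)
                  + c\<^sup>2 * (\<Sum>n=0..N. a n / pi ^ (2 * n) * B ?k n)"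
    unfolding energy_form_def sum_distrib_left sum.distrib[symmetric]
    by (intro sum.cong refl) (simp add: algebra_simps)
  finally show ?thesis by (simp only: B[OF h] B[OF k])
qed

theorem theorem2:
  fixes N :: nat and a :: "nat \<Rightarrow> real" and P :: "real \<Rightarrow> real"
    and I :: real and E :: "(complex \<Rightarrow> complex) \<Rightarrow> real"
  defines "P \<equiv> \<lambda>x. \<Sum>n=0..N. a n * x ^ n"
    and "I \<equiv> LINT t:{0..1}|lborel. 1 / P (t\<^sup>2)"
    and "E \<equiv> \<lambda>g. LINT x|lborel. (\<Sum>n=0..N. a n / pi ^ (2 * n) *
                    (cmod ((deriv ^^ n) g (complex_of_real x)))\<^sup>2)"
  assumes P_pos: "\<forall>x\<in>{0..1}. P x > 0"
  shows "(\<forall>g\<in>PW2. g 0 = 1 \<longrightarrow> inverse I \<le> E g) \<and>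
         (\<forall>g. g \<in> PW2 \<and> g 0 = 1 \<and> inverse I = E g \<longleftrightarrow>
              g = (\<lambda>z. complex_of_real (inverse I) *
                     (LINT t:{0..1}|lborel.
                        cos (complex_of_real pi * z * complex_of_real t) / complex_of_real (P (t\<^sup>2)))))"
proof -
  define \<phi> where "\<phi> = (\<lambda>t. 1 / P (t\<^sup>2))"
  \<comment> \<open>The truncated exponent at \<open>n = 0\<close> is harmless because of the factor
    \<open>real n\<close>.\<close>
  define P' where "P' = (\<lambda>x. \<Sum>n=0..N. a n * (real n * x ^ (n - 1)))"
  define \<phi>' where "\<phi>' = (\<lambda>t. - (2 * t * P' (t\<^sup>2)) / (P (t\<^sup>2))\<^sup>2)"
  have pos: "0 < P (t\<^sup>2)" if "t \<in> {0..1}" for t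
    using P_pos that by (simp add: power_le_one)
  have dP: "(P has_real_derivative P' x) (at x)" for x
    unfolding P_def P'_def by (auto intro!: derivative_eq_intros simp: mult_ac)
  have cP: "continuous_on S (\<lambda>t. P (t\<^sup>2))" and cP': "continuous_on S (\<lambda>t. P' (t\<^sup>2))" for S
    unfolding P_def P'_def by (intro continuous_intros)+
  have d\<phi>: "(\<phi> has_real_derivative \<phi>' t) (at t within {0..1})" if t: "t \<in> {0..1}" for t
  proof -
    have "((\<lambda>t. P (t\<^sup>2)) has_real_derivative P' (t\<^sup>2) * (2 * t)) (at t within {0..1})"
      by (rule DERIV_chain2[OF dP]) (auto intro!: derivative_eq_intros)
    from DERIV_inverse'[OF this] pos[OF t] show ?thesis
      by (simp add: \<phi>_def \<phi>'_def power2_eq_square field_simps)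
  qed
  have c\<phi>': "continuous_on {0..1} \<phi>'"
    unfolding \<phi>'_def by (intro continuous_intros cP cP') (use pos in force)
  have c\<phi>: "continuous_on {0..1} \<phi>" using d\<phi> by (rule DERIV_continuous_on)
  have kPW: "cos_transform \<phi> \<in> PW2" by (rule cos_transform_PW2[OF d\<phi> c\<phi>'])
  have inv: "(\<Sum>n=0..N. a n * t ^ (2 * n)) * \<phi> t = 1" if "t \<in> {0..1}" for t
    using pos[OF that] by (simp add: \<phi>_def P_def power_mult)
  have I_eq: "I = integral {0..1} \<phi>"
    unfolding I_def \<phi>_def[symmetric]
    by (rule set_borel_integral_eq_integral(2)[OF borel_integrable_atLeastAtMost'[OF c\<phi>], unfolded \<phi>_def, folded \<phi>_def])
  have "I > 0"
  proof -
    obtain t0 where t0: "t0 \<in> {0..1}" "\<And>t. t \<in> {0..1} \<Longrightarrow> \<phi> t0 \<le> \<phi> t"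
      using continuous_attains_inf[OF _ _ c\<phi>] by auto
    have "integral {0..1::real} (\<lambda>_. \<phi> t0) \<le> integral {0..1} \<phi>"
      by (intro integral_le integrable_continuous_real c\<phi> t0(2)) auto
    moreover have "0 < \<phi> t0" using pos[OF t0(1)] by (simp add: \<phi>_def)
    ultimately show ?thesis by (simp add: I_eq)
  qed
  have k0: "cos_transform \<phi> 0 = of_real I"
    using cos_transform_of_real[OF c\<phi>, of 0] by (simp add: I_eq)
  define G where "G = (\<lambda>z. of_real (inverse I) * cos_transform \<phi> z)"
  have G: "(\<lambda>z. complex_of_real (inverse I) * (LINT t:{0..1}|lborel.
                 cos (complex_of_real pi * z * complex_of_real t) / complex_of_real (P (t\<^sup>2)))) = G"
  proof -
    have "(LINT t:{0..1}|lborel. cos (complex_of_real pi * z * complex_of_real t) / complex_of_real (P (t\<^sup>2)))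
          = cos_transform \<phi> z" for z
    proof -
      have "continuous_on {0..1} (\<lambda>t. cos (complex_of_real pi * z * complex_of_real t) / complex_of_real (P (t\<^sup>2)))"
        by (intro continuous_intros cP) (use pos in force)
      from set_borel_integral_eq_integral(2)[OF borel_integrable_atLeastAtMost'[OF this]]
      show ?thesis by (simp add: cos_transform_def \<phi>_def mult_ac)
    qed
    thus ?thesis by (simp add: G_def)
  qed
  have GPW: "G \<in> PW2" unfolding G_def by (rule PW2_cmult[OF kPW])
  have G0: "G 0 = 1" using \<open>I > 0\<close> by (simp add: G_def k0)
  obtain \<epsilon> where "\<epsilon> > 0" and coercive: "\<And>f. f \<in> PW2 \<Longrightarrow> \<epsilon> * line_energy f \<le> energy_form a N f"
    using energy_form_coercive[of a N] P_pos unfolding P_def energy_form_def by blast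
  \<comment> \<open>\<open>h 0 = 0\<close> kills the cross term, and since the kernel has value
    \<open>I\<close> at 0, its share is \<open>(inverse I)\<^sup>2 * I\<close>.\<close>
  have E_split: "E (\<lambda>z. h z + G z) = energy_form a N h + inverse I" if h: "h \<in> PW2" "h 0 = 0" for h
  proof -
    have "E (\<lambda>z. h z + G z) = energy_form a N (\<lambda>z. h z + G z)"
      unfolding E_def by (rule integral_energy_density[OF PW2_add[OF h(1) GPW]])
    also have "\<dots> = energy_form a N h + 2 * inverse I * Re (h 0) + (inverse I)\<^sup>2 * Re (cos_transform \<phi> 0)"
      unfolding G_def by (rule energy_form_add_kernel[OF c\<phi> kPW inv h(1)])
    finally have "E (\<lambda>z. h z + G z) = energy_form a N h + (inverse I)\<^sup>2 * I"
      by (simp add: h(2) k0)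
    thus ?thesis using \<open>I > 0\<close> by (simp add: power2_eq_square)
  qed
  have main: "inverse I \<le> E g \<and> (inverse I = E g \<longrightarrow> g = G)" if g: "g \<in> PW2" "g 0 = 1" for g
  proof -
    define h where "h = (\<lambda>z. g z + (- 1) * G z)"
    have h: "h \<in> PW2" unfolding h_def by (intro PW2_add g PW2_cmult GPW)
    have "h 0 = 0" by (simp add: h_def g G0)
    have "g = (\<lambda>z. h z + G z)" by (simp add: h_def)
    hence Eg: "E g = energy_form a N h + inverse I" using E_split[OF h \<open>h 0 = 0\<close>] by simp
    have le: "\<epsilon> * line_energy h \<le> energy_form a N h" by (rule coercive[OF h])
    have "0 \<le> \<epsilon> * line_energy h" using \<open>\<epsilon> > 0\<close> line_energy_nonneg by simp
    moreover have "g = G" if "inverse I = E g"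
    proof -
      have "\<epsilon> * line_energy h \<le> 0" using le Eg that by simp
      hence "line_energy h = 0"
        using \<open>\<epsilon> > 0\<close> line_energy_nonneg[of h] by (simp add: mult_le_0_iff)
      hence "h z = 0" for z by (rule line_energy_eq_0_imp[OF h])
      thus "g = G" by (simp add: h_def fun_eq_iff)
    qed
    ultimately show ?thesis using le Eg by linarith
  qed
  have "E G = inverse I"
  proof -
    \<comment> \<open>Taking \<open>h = 0\<close> in the splitting shows that \<open>G\<close>
      attains the bound.\<close>
    have z: "(\<lambda>z. 0) \<in> PW2" using PW2_cmult[OF GPW, of 0] by simp
    have "(deriv ^^ n) (\<lambda>z. 0) = (\<lambda>z::complex. 0 :: complex)" for n by (induction n) auto
    hence "energy_form a N (\<lambda>z. 0) = 0" by (simp add: energy_form_def line_energy_def)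
    thus ?thesis using E_split[OF z] by simp
  qed
  show ?thesis
    unfolding G using main GPW G0 \<open>E G = inverse I\<close> by metis
qed

end
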